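(* Let $d\ge1$, $\boldsymbol\varsigma\in\{+,-\}^{d+1}$ and $\boldsymbol\lambda\in\mathbb C^{d+1}$ with $\sum_{l=1}^{d+1}\lambda_l=0$. The Bessel function $w=J(x;\boldsymbol\varsigma,\boldsymbol\lambda)$, $x>0$, satisfies the linear differential equation of order $d+1$ $$\sum_{j=1}^{d+1}V_{d+1,j}(\boldsymbol\lambda)x^jw^{(j)}+\Big(V_{d+1,0}(\boldsymbol\lambda)-S_{d+1}(\boldsymbol\varsigma)(i(d+1))^{d+1}x^{d+1}\Big)w=0,$$ where $$S_{d+1}(\boldsymbol\varsigma)=\prod_{l=1}^{d+1}\varsigma_l,\qquad V_{d+1,j}(\boldsymbol\lambda)=\sum_{m=0}^{d-j+1}A_{j,d-j-m+1}(d+1)^m\sigma_m(\boldsymbol\lambda),$$ $\sigma_m(\boldsymbol\lambda)$ denotes the elementary symmetric polynomial in $\boldsymbol\lambda$ of degree $m$ (so $\sigma_1(\boldsymbol\lambda)=0$), and the integers $A_{j,m}$ are those defined in the context.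
   Context: Notation: $e(w)=e^{2\pi iw}$, $\mathbb N=\{0,1,\dots\}$; signs $\pm$ are identified with $\pm1$. The integers $A_{j,m}$ ($j,m\ge-1$, $(j,m)\ne(-1,-1)$) are defined by $A_{-1,0}=1$, $A_{-1,m}=0$ for $m\ge1$, $A_{j,-1}=0$ for $j\ge0$, and $A_{j,m}=jA_{j,m-1}+A_{j-1,m}$ for $j,m\ge0$. Explicitly $A_{0,0}=1$, $A_{0,m}=0$ for $m\ge1$, and $A_{j,m}=\sum_{r=1}^j\frac{(-1)^{j-r}r^{m+j}}{r!(j-r)!}$ for $j\ge1$, $m\ge0$. With $n=d+1$, for $x>0$, $$J(x;\boldsymbol\varsigma,\boldsymbol\lambda)=\frac1{2\pi i}\int_{\mathcal C}\prod_{l=1}^n\Gamma(s-\lambda_l)\,e\Big(\frac{\varsigma_l(s-\lambda_l)}4\Big)\,x^{-ns}ds,$$ where $\mathcal C$ is any contour going upward from $\sigma-i\infty$ to $\sigma+i\infty$ with $\sigma<\frac12+\frac1n(\mathrm{Re}\sum_l\lambda_l-1)$, having all the sets $\lambda_l-\mathbb N$ on its left, and with $\mathrm{Re}\,s=\sigma$ for $s\in\mathcal C$ with $|\mathrm{Im}\,s|$ large. *)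

theory Defs
  imports "HOL-Analysis.Analysis"
begin

text \<open>
  A vector \<open>(v\<^sub>1, \<dots>, v\<^sub>n)\<close> is a function on \<open>nat\<close> of which only the values on \<open>{1..n}\<close> matter;
  a sign is an integer in \<open>{1, -1}\<close>.
\<close>

definition e2pi :: "complex \<Rightarrow> complex" where
  "e2pi w = exp (2 * of_real pi * \<i> * w)"

text \<open>The index domain is \<open>j, m \<ge> -1\<close> without \<open>(-1, -1)\<close>; elsewhere the value 0 is a dummy.\<close>

function coeffA :: "int \<Rightarrow> int \<Rightarrow> int" where
  "coeffA j m =
    (if j < -1 \<or> m < -1 \<or> (j = -1 \<and> m = -1) then 0
     else if j = -1 then (if m = 0 then 1 else 0)
     else if m = -1 then 0
     else j * coeffA j (m - 1) + coeffA (j - 1) m)"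
  by pat_completeness auto
termination
  by (relation "Wellfounded.measure (\<lambda>(j, m). nat (j + m + 2))") auto

declare coeffA.simps [simp del]

definition elem_sym :: "nat \<Rightarrow> (nat \<Rightarrow> complex) \<Rightarrow> nat \<Rightarrow> complex" where
  "elem_sym n lam m = (\<Sum>M | M \<subseteq> {1..n} \<and> card M = m. \<Prod>l\<in>M. lam l)"

definition coeffV :: "nat \<Rightarrow> nat \<Rightarrow> (nat \<Rightarrow> complex) \<Rightarrow> complex" where
  "coeffV n j lam =
    (\<Sum>m=0..n - j. of_int (coeffA (int j) (int n - int j - int m)) * of_nat n ^ m * elem_sym n lam m)"

definition sign_prod :: "nat \<Rightarrow> (nat \<Rightarrow> int) \<Rightarrow> int" where
  "sign_prod n sgns = (\<Prod>l=1..n. sgns l)"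

text \<open>
  A point is to the left of an upward contour if it can be joined to a left half-plane without
  meeting the contour.
\<close>

definition left_of_contour :: "(real \<Rightarrow> complex) \<Rightarrow> complex \<Rightarrow> bool" where
  "left_of_contour \<gamma> z \<longleftrightarrow>
    (\<exists>r. \<forall>u. Re u < r \<longrightarrow> connected_component (- range \<gamma>) u z)"

text \<open>
  The contours in the definition of \<open>J\<close>, parametrised over the whole real line. The two vertical
  ends are parametrised by height, which is no restriction since contour integrals do not depend
  on the parametrisation; the middle part is an arbitrary piecewise continuously differentiable
  path.
\<close>

definition bessel_contour :: "nat \<Rightarrow> (nat \<Rightarrow> complex) \<Rightarrow> (real \<Rightarrow> complex) \<Rightarrow> bool" where
  "bessel_contour n lam \<gamma> \<longleftrightarrow>
    (\<exists>\<sigma> T. \<sigma> < 1 / 2 + 1 / real n * (Re (\<Sum>l=1..n. lam l) - 1) \<and>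
           0 < T \<and> (\<forall>t. T \<le> \<bar>t\<bar> \<longrightarrow> \<gamma> t = Complex \<sigma> t) \<and>
           \<gamma> piecewise_C1_differentiable_on {-T..T}) \<and>
    (\<forall>l\<in>{1..n}. \<forall>k::nat. left_of_contour \<gamma> (lam l - of_nat k))"

definition infinite_contour_integral :: "(real \<Rightarrow> complex) \<Rightarrow> (complex \<Rightarrow> complex) \<Rightarrow> complex" where
  "infinite_contour_integral \<gamma> f = integral UNIV (\<lambda>t. f (\<gamma> t) * vector_derivative \<gamma> (at t))"

definition bessel_J ::
  "nat \<Rightarrow> (nat \<Rightarrow> int) \<Rightarrow> (nat \<Rightarrow> complex) \<Rightarrow> (real \<Rightarrow> complex) \<Rightarrow> real \<Rightarrow> complex" where
  "bessel_J n sgns lam \<gamma> x =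
    1 / (2 * of_real pi * \<i>) *
    infinite_contour_integral \<gamma>
      (\<lambda>s. (\<Prod>l=1..n. Gamma (s - lam l) * e2pi (of_int (sgns l) * (s - lam l) / 4)) *
           of_real x powr (- of_nat n * s))"

definition iter_deriv :: "nat \<Rightarrow> (real \<Rightarrow> complex) \<Rightarrow> real \<Rightarrow> complex" where
  "iter_deriv j f = ((\<lambda>g x. vector_derivative g (at x)) ^^ j) f"

end

theory Submission
  imports Defs "HOL-Complex_Analysis.Complex_Analysis"
begin

text \<open>
  Write \<open>F\<close> for the product of Gamma and exponential factors. The functional equation of Gamma reads
  \<open>F(s) (s - \<lambda>\<^sub>1) \<cdots> (s - \<lambda>\<^sub>n) = (-i)\<^sup>n S F(s + 1)\<close>, while \<open>x d/dx\<close> acts on \<open>x\<^sup>-\<^sup>n\<^sup>s\<close> as multiplication by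
  \<open>-ns\<close>. Hence the Euler operator \<open>\<Prod> (x d/dx + n \<lambda>\<^sub>l)\<close> maps \<open>w\<close> to \<open>(in)\<^sup>n S x\<^sup>n\<close> times the same integral
  over the contour shifted by \<open>1\<close>, and expanding it in the \<open>x\<^sup>j (d/dx)\<^sup>j\<close> produces the \<open>A\<^sub>j\<^sub>,\<^sub>m\<close> as
  Stirling numbers of the second kind.

  Since \<open>|F(\<sigma> + it)|\<close> is only \<open>O(|t|\<^bsup>n(\<sigma> - 1/2)\<^esup>)\<close>, one may neither differentiate under the given integral sign
  nor shift the contour to the right. The contour is therefore first replaced by a smooth graph
  whose ends lie far to the left. The replacement is legitimate because the part of each contour
  below height \<open>R\<close>, closed up through the right half-plane, has winding number \<open>0\<close> around every pole.
\<close>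

section \<open>Gamma on vertical lines\<close>

text \<open>Each Gamma factor decays like exp(-pi |t| / 2), and its exponential factor undoes this
  exactly in one of the two vertical directions, whatever the sign. Only the power |t|^(n (Re s -
  1/2)) is left, and it is integrable just when Re s < 1/2 - 1/n, which is the condition on the ends
  of the given contour. A fixed loss in the exponent would therefore exclude admissible contours, so
  the Gamma bound must have the exact power of |t|. It comes from the convexity in u of ln Gamma(u)
  - ln |Gamma(u + it)|, which extends closed formulas on two vertical lines to all lines. No residue
  is computed. The function w is represented over two humps with asymptotes Re s = -4 and Re s = -3,
  which are translates of each other by 1. The functional equation turns the integrand on the first
  into the integrand on the second by mere substitution. On the first hump the kernel is
  O(|t|^(-7n/2)), enough to absorb the n + 1 powers of |t| that n differentiations cost.\<close>

lemma convex_on_eq: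
  assumes "convex_on S f" "\<And>x. x \<in> S \<Longrightarrow> f x = g x"
  shows "convex_on S g"
proof -
  have "convex S" using assms(1) by (rule convex_on_imp_convex)
  then have "u *\<^sub>R x + v *\<^sub>R y \<in> S" if "x \<in> S" "y \<in> S" "0 \<le> u" "0 \<le> v" "u + v = 1" for x y u v
    using that by (simp add: convex_def)
  then show ?thesis
    using assms unfolding convex_on_def by auto
qed

text \<open>Splitting the logarithm of the quotient makes the second derivative a single fraction of
  visibly nonnegative quantities.\<close>

lemma convex_on_ln_one_plus_sq_over_sq:
  "convex_on {0<..} (\<lambda>y::real. ln (1 + t\<^sup>2 / y\<^sup>2))"
proof -
  have "convex_on {0<..} (\<lambda>y::real. ln (y\<^sup>2 + t\<^sup>2) - 2 * ln y)"
  proof (rule f''_ge0_imp_convex)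
    fix y :: real assume "y \<in> {0<..}"
    then have y: "y > 0" by simp
    have p: "y\<^sup>2 + t\<^sup>2 > 0" using y by (simp add: add_pos_nonneg)
    show "((\<lambda>y. ln (y\<^sup>2 + t\<^sup>2) - 2 * ln y) has_real_derivative 2 * y / (y\<^sup>2 + t\<^sup>2) - 2 / y) (at y)"
      using p y by (auto intro!: derivative_eq_intros simp: field_simps)
    have "((\<lambda>y. 2 * y / (y\<^sup>2 + t\<^sup>2) - 2 / y) has_real_derivative
        (2 * (y\<^sup>2 + t\<^sup>2) - 2 * y * (2 * y)) / (y\<^sup>2 + t\<^sup>2)\<^sup>2 + 2 / y\<^sup>2) (at y)"
      using p y by (auto intro!: derivative_eq_intros simp: power2_eq_square)
    then show "((\<lambda>y. 2 * y / (y\<^sup>2 + t\<^sup>2) - 2 / y) has_real_derivative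
        2 * t\<^sup>2 * (3 * y\<^sup>2 + t\<^sup>2) / (y\<^sup>2 * (y\<^sup>2 + t\<^sup>2)\<^sup>2)) (at y)"
    proof (rule back_subst[where P = "\<lambda>D. (_ has_real_derivative D) _"])
      show "(2 * (y\<^sup>2 + t\<^sup>2) - 2 * y * (2 * y)) / (y\<^sup>2 + t\<^sup>2)\<^sup>2 + 2 / y\<^sup>2
        = 2 * t\<^sup>2 * (3 * y\<^sup>2 + t\<^sup>2) / (y\<^sup>2 * (y\<^sup>2 + t\<^sup>2)\<^sup>2)"
        using p y by (simp add: divide_simps) (simp add: power2_eq_square algebra_simps)
    qed
    show "0 \<le> 2 * t\<^sup>2 * (3 * y\<^sup>2 + t\<^sup>2) / (y\<^sup>2 * (y\<^sup>2 + t\<^sup>2)\<^sup>2)"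
      by simp
  qed simp
  moreover have "ln (y\<^sup>2 + t\<^sup>2) - 2 * ln y = ln (1 + t\<^sup>2 / y\<^sup>2)" if "y \<in> {0<..}" for y
  proof -
    have y: "y > 0" using that by simp
    have "1 + t\<^sup>2 / y\<^sup>2 = (y\<^sup>2 + t\<^sup>2) / y\<^sup>2" using y by (simp add: field_simps)
    then show ?thesis using y by (simp add: ln_div ln_realpow add_pos_nonneg)
  qed
  ultimately show ?thesis
    by (rule convex_on_eq)
qed

text \<open>By the product formula this function is \<open>\<Sum>k. ln (1 + t\<^sup>2 / (u + k)\<^sup>2) / 2\<close>.\<close>

lemma convex_on_ln_Gamma_minus_ln_norm_Gamma:
  "convex_on {0<..} (\<lambda>u. ln (Gamma u) - ln (norm (Gamma (Complex u t))))"
proof -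
  define S where "S n u = (\<Sum>k\<le>n. ln (1 + t\<^sup>2 / (u + real k)\<^sup>2) / 2)" for n u
  have conv: "convex_on {0<..} (S n)" for n
  proof -
    have "convex_on {0<..} (\<lambda>u. ln (1 + t\<^sup>2 / (u + real k)\<^sup>2))" for k
    proof -
      have "convex_on {0<..} (\<lambda>u. ln (1 + t\<^sup>2 / u\<^sup>2))" by (rule convex_on_ln_one_plus_sq_over_sq)
      then show ?thesis
        unfolding convex_on_def
      proof (safe, goal_cases)
        case (1 x y u v)
        have "u * x + v * y + k = u * (x + k) + v * (y + k)"
          using 1 by (simp add: algebra_simps flip: distrib_right)
        moreover have "x + k \<in> {0<..}" "y + k \<in> {0<..}" using 1 by auto
        ultimately show ?case using 1 by auto
      qed
    qed
    then have "convex_on {0<..} (\<lambda>u. ln (1 + t\<^sup>2 / (u + real k)\<^sup>2) / 2)" for k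
      using convex_on_cmul[of "1/2"] by force
    then show ?thesis
      unfolding S_def
    proof (induction n)
      case 0
      show ?case using 0(1)[of 0] by simp
    next
      case (Suc n)
      then show ?case by (simp only: sum.atMost_Suc convex_on_add)
    qed
  qed
  have lim: "(\<lambda>n. S n u) \<longlonglongrightarrow> ln (Gamma u) - ln (norm (Gamma (Complex u t)))" if u: "u > 0" for u
  proof -
    have nz: "Complex u t \<notin> \<int>\<^sub>\<le>\<^sub>0" using u by (auto elim!: nonpos_Ints_cases simp: complex_eq_iff)
    have "(\<lambda>n. ln (Gamma_series u n) - ln (norm (Gamma_series (Complex u t) n)))
        \<longlonglongrightarrow> ln (Gamma u) - ln (norm (Gamma (Complex u t)))"
      using Gamma_real_pos[OF u] nz
      by (intro tendsto_intros) (simp add: less_imp_neq[symmetric], simp add: Gamma_eq_zero_iff)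
    moreover have "\<forall>\<^sub>F n in sequentially.
        ln (Gamma_series u n) - ln (norm (Gamma_series (Complex u t) n)) = S n u"
      using eventually_gt_at_top[of 0]
    proof eventually_elim
      fix n :: nat assume n: "n > 0"
      have uk: "u + real k > 0" for k using u by simp
      have nzk: "Complex u t + of_nat k \<noteq> 0" for k
        using uk[of k] by (auto simp: complex_eq_iff)
      have lnG: "ln (Gamma_series u n) = ln (fact n * exp (u * ln n)) - (\<Sum>k\<le>n. ln (u + k))"
        unfolding Gamma_series_def pochhammer_prod
        using uk n ln_prod[of "{..n}" "\<lambda>k. u + real k"]
        by (subst ln_div) (simp_all add: prod_pos lessThan_Suc_atMost atLeast0LessThan less_imp_neq[symmetric])
      \<comment> \<open>The numerator n! n^s of the product formula has a modulus depending on Re s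
        only. It is therefore the same for \<open>u\<close> and \<open>Complex u t\<close> and
        cancels, leaving the linear factors.\<close>
      have "norm (Gamma_series (Complex u t) n)
          = fact n * exp (u * ln n) / (\<Prod>k\<le>n. norm (Complex u t + of_nat k))"
        unfolding Gamma_series_def pochhammer_prod
        by (simp add: norm_divide norm_mult prod_norm[symmetric] lessThan_Suc_atMost atLeast0LessThan)
      then have lnN: "ln (norm (Gamma_series (Complex u t) n)) =
          ln (fact n * exp (u * ln n)) - (\<Sum>k\<le>n. ln (norm (Complex u t + of_nat k)))"
        using nzk ln_prod[of "{..n}" "\<lambda>k. norm (Complex u t + of_nat k)"]
        by (simp only:) (subst ln_div, simp_all)
      have factor: "ln (norm (Complex u t + of_nat k)) - ln (u + k) = ln (1 + t\<^sup>2 / (u + real k)\<^sup>2) / 2" for k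
      proof -
        have "norm (Complex u t + of_nat k) = sqrt ((u + k)\<^sup>2 + t\<^sup>2)"
          by (simp add: cmod_def)
        moreover have "(u + k)\<^sup>2 + t\<^sup>2 = (u + k)\<^sup>2 * (1 + t\<^sup>2 / (u + real k)\<^sup>2)"
          using uk[of k] by (simp add: field_simps)
        ultimately have "norm (Complex u t + of_nat k) = (u + k) * sqrt (1 + t\<^sup>2 / (u + real k)\<^sup>2)"
          using uk[of k] by (simp only: real_sqrt_mult) simp
        moreover have "1 + t\<^sup>2 / (u + real k)\<^sup>2 > 0" by (simp add: add_pos_nonneg)
        ultimately show ?thesis using uk[of k]
          by (simp add: ln_mult ln_sqrt)
      qed
      have "S n u = (\<Sum>k\<le>n. ln (norm (Complex u t + of_nat k))) - (\<Sum>k\<le>n. ln (u + k))"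
        unfolding S_def by (rule trans[OF sum.cong[OF refl factor[symmetric]] sum_subtractf])
      then show "ln (Gamma_series u n) - ln (norm (Gamma_series (Complex u t) n)) = S n u"
        unfolding lnG lnN by simp
    qed
    ultimately show ?thesis by (rule Lim_transform_eventually)
  qed
  show ?thesis
    unfolding convex_on_def
  proof (intro conjI ballI allI impI)
    fix x y u v :: real
    assume xy: "x \<in> {0<..}" "y \<in> {0<..}" and uv: "0 \<le> u" "0 \<le> v" "u + v = 1"
    have z: "u *\<^sub>R x + v *\<^sub>R y \<in> {0<..}"
      by (rule convexD) (use xy uv in auto)
    let ?P = "\<lambda>u. ln (Gamma u) - ln (norm (Gamma (Complex u t)))"
    show "?P (u *\<^sub>R x + v *\<^sub>R y) \<le> u * ?P x + v * ?P y"
    proof (rule LIMSEQ_le)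
      show "(\<lambda>n. S n (u *\<^sub>R x + v *\<^sub>R y)) \<longlonglongrightarrow> ?P (u *\<^sub>R x + v *\<^sub>R y)" using z by (intro lim) simp
      show "(\<lambda>n. u * S n x + v * S n y) \<longlonglongrightarrow> u * ?P x + v * ?P y"
        using xy by (intro tendsto_intros lim) auto
      show "\<exists>N. \<forall>n\<ge>N. S n (u *\<^sub>R x + v *\<^sub>R y) \<le> u * S n x + v * S n y"
        using conv[unfolded convex_on_def, THEN conjunct2, rule_format, OF xy uv] by blast
    qed
  qed simp
qed

lemma norm_Gamma_half_line:
  "(norm (Gamma (Complex (1/2) t)))\<^sup>2 = pi / cosh (pi * t)"
proof -
  let ?z = "Complex (1/2) t"
  have "1 - ?z = cnj ?z" by (simp add: complex_eq_iff)
  then have "Gamma ?z * cnj (Gamma ?z) = of_real pi / sin (of_real pi * ?z)"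
    using Gamma_reflection_complex[of ?z] by (simp add: cnj_Gamma)
  also have "of_real pi * ?z = of_real pi / 2 - (- (\<i> * of_real (pi * t)))"
    by (simp add: complex_eq_iff)
  also have "sin \<dots> = cos (\<i> * of_real (pi * t))"
    by (subst sin_diff) simp
  also have "\<dots> = of_real (cosh (pi * t))"
    by (simp add: cosh_def cos_exp_eq scaleR_conv_of_real flip: exp_of_real)
  finally have "complex_of_real ((norm (Gamma ?z))\<^sup>2) = of_real (pi / cosh (pi * t))"
    by (simp only: complex_norm_square of_real_divide)
  then show ?thesis by (simp only: of_real_eq_iff)
qed

text \<open>Gamma(1 + it) = it Gamma(it), and 1 - it is the conjugate of 1 + it, so one step of the
  recurrence makes the reflection formula applicable. At t = 0 it would involve the pole of
  Gamma.\<close>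

lemma norm_Gamma_one_line:
  assumes "t \<noteq> 0"
  shows "(norm (Gamma (Complex 1 t)))\<^sup>2 = pi * t / sinh (pi * t)"
proof -
  let ?z = "\<i> * of_real t"
  have z1: "Complex 1 t = ?z + 1" by (simp add: complex_eq_iff)
  have nz: "?z \<notin> \<int>\<^sub>\<le>\<^sub>0" using assms by (auto elim!: nonpos_Ints_cases simp: complex_eq_iff)
  have c: "1 - ?z = cnj (Complex 1 t)" by (simp add: complex_eq_iff)
  have "Gamma (Complex 1 t) * cnj (Gamma (Complex 1 t)) = ?z * (Gamma ?z * Gamma (1 - ?z))"
    unfolding cnj_Gamma c[symmetric] using Gamma_plus1[OF nz] by (simp add: z1)
  also have "\<dots> = ?z * (of_real pi / sin (of_real pi * ?z))"
    by (simp only: Gamma_reflection_complex)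
  also have "of_real pi * ?z = \<i> * of_real (pi * t)" by simp
  also have "sin (\<i> * of_real (pi * t)) = \<i> * of_real (sinh (pi * t))"
    by (simp add: sinh_def sin_exp_eq scaleR_conv_of_real field_simps flip: exp_of_real)
  also have "?z * (of_real pi / (\<i> * of_real (sinh (pi * t)))) = of_real (pi * t / sinh (pi * t))"
    by simp
  finally have "complex_of_real ((norm (Gamma (Complex 1 t)))\<^sup>2) = of_real (pi * t / sinh (pi * t))"
    by (simp only: complex_norm_square)
  then show ?thesis by (simp only: of_real_eq_iff)
qed

text \<open>A convex function lies above its secant outside the interval: the values on the lines
  \<open>Re s = 1/2\<close> and \<open>Re s = 1\<close>, known from the reflection formula, control all lines to the right.\<close>

lemma norm_Gamma_le_right:
  assumes u: "u \<ge> 1" and t: "t \<ge> 1"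
  shows "norm (Gamma (Complex u t)) \<le> Gamma u * (sqrt 2 * (2 * pi * t) powr (u - 1/2) * exp (- (pi * t / 2)))"
proof -
  define P where "P u = ln (Gamma u) - ln (norm (Gamma (Complex u t)))" for u
  have conv: "convex_on {0<..} P"
    unfolding P_def by (rule convex_on_ln_Gamma_minus_ln_norm_Gamma)
  \<comment> \<open>This makes 1 the convex combination of 1/2 and \<open>u\<close> with weights
    \<open>1 - a\<close> and \<open>a\<close>. The secant over [1/2, 1] is then prolonged by the
    factor 1/a = 2u - 1, the source of the exponent u - 1/2.\<close>
  define a where "a = (1/2) / (u - 1/2)"
  have a: "0 < a" "a \<le> 1" using u by (auto simp: a_def field_simps)
  have "P ((1 - a) *\<^sub>R (1/2) + a *\<^sub>R u) \<le> (1 - a) * P (1/2) + a * P u"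
    using conv a u unfolding convex_on_def by (auto simp del: scaleR_conv_of_real real_scaleR_def)
  also have "(1 - a) *\<^sub>R (1/2) + a *\<^sub>R u = 1"
  proof -
    have "a * (u - 1/2) = 1/2" using u by (simp add: a_def)
    then have "a * u = 1/2 + a/2" by (simp add: algebra_simps)
    then show ?thesis by (simp add: diff_divide_distrib)
  qed
  finally have "a * (P u - P (1/2)) \<ge> P 1 - P (1/2)" by (simp add: algebra_simps)
  then have "P u - P (1/2) \<ge> (P 1 - P (1/2)) / a" using a by (simp add: field_simps)
  then have Pu: "P u \<ge> P (1/2) + (2 * u - 1) * (P 1 - P (1/2))"
    by (simp add: a_def algebra_simps)
  have nz: "Gamma (Complex v t) \<noteq> 0" for v
    unfolding Gamma_eq_zero_iff using t by (auto elim!: nonpos_Ints_cases simp: complex_eq_iff)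
  have c: "cosh (pi * t) > 0" and s: "sinh (pi * t) > 0" using t by auto
  have h: "ln (norm (Gamma (Complex (1/2) t))) = (ln pi - ln (cosh (pi * t))) / 2"
  proof -
    have "ln ((norm (Gamma (Complex (1/2) t)))\<^sup>2) = ln pi - ln (cosh (pi * t))"
      unfolding norm_Gamma_half_line using c by (simp add: ln_div)
    then show ?thesis using nz[of "1/2"] by (simp add: ln_realpow)
  qed
  have o: "ln (norm (Gamma (Complex 1 t))) = (ln (pi * t) - ln (sinh (pi * t))) / 2"
  proof -
    have "ln ((norm (Gamma (Complex 1 t)))\<^sup>2) = ln (pi * t) - ln (sinh (pi * t))"
      using t s by (subst norm_Gamma_one_line) (simp_all add: ln_div)
    then show ?thesis using nz[of 1] by (simp add: ln_realpow)
  qed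
  have P12: "P (1/2) = ln (cosh (pi * t)) / 2"
    unfolding P_def h by (simp add: Gamma_one_half_real ln_sqrt field_simps)
  have P1: "P 1 = (ln (sinh (pi * t)) - ln (pi * t)) / 2"
    unfolding P_def o by (simp add: field_simps)
  \<comment> \<open>This gives cosh \<le> 2 sinh at pi t, so the ratio of the two closed formulas
    costs at most a factor 2; it reappears in the base \<open>2 * pi * t\<close> of the
    bound.\<close>
  have e2: "2 \<le> exp (pi * t)"
  proof -
    have "1 \<le> pi * t" using t pi_ge_two mult_mono[of 1 pi 1 t] by simp
    then show ?thesis using exp_ge_add_one_self[of "pi * t"] by linarith
  qed
  have lc: "ln (cosh (pi * t)) \<ge> pi * t - ln 2"
  proof -
    have "cosh (pi * t) \<ge> exp (pi * t) / 2" by (simp add: cosh_def)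
    then have "ln (cosh (pi * t)) \<ge> ln (exp (pi * t) / 2)" using c by (subst ln_le_cancel_iff) auto
    then show ?thesis by (simp add: ln_div)
  qed
  have "cosh (pi * t) \<le> 2 * sinh (pi * t)"
  proof -
    have "exp (- (pi * t)) \<le> 1 / 2" using e2 by (simp add: exp_minus field_simps)
    then show ?thesis using e2 by (simp add: cosh_def sinh_def)
  qed
  then have "ln (cosh (pi * t)) \<le> ln (2 * sinh (pi * t))" using c s by (subst ln_le_cancel_iff) auto
  then have "ln (cosh (pi * t)) \<le> ln 2 + ln (sinh (pi * t))" using s t by (simp add: ln_mult)
  then have "P 1 - P (1/2) \<ge> - ln (2 * pi * t) / 2"
    using t unfolding P1 P12 by (simp add: ln_mult field_simps)
  then have "(2 * u - 1) * (P 1 - P (1/2)) \<ge> (2 * u - 1) * (- ln (2 * pi * t) / 2)"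
    using u by (intro mult_left_mono) auto
  with Pu lc have "P u \<ge> (pi * t - ln 2) / 2 - (u - 1/2) * ln (2 * pi * t)"
    unfolding P12 by (simp add: field_simps)
  then have "ln (norm (Gamma (Complex u t))) \<le> ln (Gamma u) + ln 2 / 2 + (u - 1/2) * ln (2 * pi * t) - pi * t / 2"
    unfolding P_def by (simp add: field_simps)
  then have "exp (ln (norm (Gamma (Complex u t))))
      \<le> exp (ln (Gamma u) + ln 2 / 2 + (u - 1/2) * ln (2 * pi * t) - pi * t / 2)"
    by simp
  also have "\<dots> = Gamma u * (sqrt 2 * (2 * pi * t) powr (u - 1/2) * exp (- (pi * t / 2)))"
  proof -
    have "exp (ln 2 / 2) = sqrt (2::real)" by (simp flip: ln_sqrt)
    moreover have "exp (ln (Gamma u)) = Gamma u" using u Gamma_real_pos[of u] by simp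
    moreover have "exp ((u - 1/2) * ln (2 * pi * t)) = (2 * pi * t) powr (u - 1/2)"
      using t by (simp add: powr_def)
    ultimately show ?thesis
      by (simp only: diff_conv_add_uminus exp_add mult.assoc)
  qed
  finally show ?thesis using nz[of u] by simp
qed

text \<open>The recurrence moves the strip N units to the right of Re s = 1. Each of the N factors s
  + i has modulus at least |t|, which compensates exactly for the N extra powers of |t| there.
  Compactness makes the constant uniform in u, and conjugation covers negative t.\<close>

lemma norm_Gamma_le_strip:
  fixes a b :: real
  shows "\<exists>C>0. \<forall>u\<in>{a..b}. \<forall>t. \<bar>t\<bar> \<ge> 1 \<longrightarrow>
    norm (Gamma (Complex u t)) \<le> C * \<bar>t\<bar> powr (u - 1/2) * exp (- (pi * \<bar>t\<bar> / 2))"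
proof -
  obtain N :: nat where N: "a + N \<ge> 1"
    using real_arch_simple[of "1 - a"] by (auto simp: algebra_simps)
  have "compact (Gamma ` {a + N..b + N})"
    using N by (intro compact_continuous_image continuous_intros) (auto elim!: nonpos_Ints_cases)
  then obtain G where G: "\<And>u. u \<in> {a + N..b + N} \<Longrightarrow> \<bar>Gamma u\<bar> \<le> G" and G0: "G > 0"
    using compact_imp_bounded[THEN bounded_pos[THEN iffD1]] by (metis imageI real_norm_def)
  define C where "C = G * (sqrt 2 * (2 * pi) powr (\<bar>b\<bar> + N))"
  have pos: "norm (Gamma (Complex u t)) \<le> C * t powr (u - 1/2) * exp (- (pi * t / 2))"
    if u: "u \<in> {a..b}" and t: "t \<ge> 1" for u t
  proof -
    let ?s = "Complex u t"
    have nz: "?s \<notin> \<int>\<^sub>\<le>\<^sub>0" using t by (auto elim!: nonpos_Ints_cases simp: complex_eq_iff)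
    have uN: "u + N \<ge> 1" using u N by auto
    have "t ^ N = (\<Prod>i=0..<N. t)" by simp
    also have "\<dots> \<le> (\<Prod>i=0..<N. norm (?s + of_nat i))"
      using t abs_Im_le_cmod[of "?s + of_nat i" for i] by (intro prod_mono) auto
    also have "\<dots> = norm (pochhammer ?s N)" by (simp add: pochhammer_prod prod_norm)
    also have "\<dots> = norm (Gamma (?s + of_nat N)) / norm (Gamma ?s)"
      using nz by (simp add: pochhammer_Gamma norm_divide)
    finally have "norm (Gamma ?s) * t ^ N \<le> norm (Gamma (?s + of_nat N))"
      using nz by (simp add: Gamma_eq_zero_iff field_simps)
    also have "?s + of_nat N = Complex (u + N) t" by (simp add: complex_eq_iff)
    also have "norm (Gamma \<dots>) \<le> Gamma (u + N) * (sqrt 2 * (2 * pi * t) powr (u + N - 1/2) * exp (- (pi * t / 2)))"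
      using uN t by (rule norm_Gamma_le_right)
    also have "\<dots> \<le> G * (sqrt 2 * ((2 * pi) powr (\<bar>b\<bar> + N) * t powr (u + N - 1/2)) * exp (- (pi * t / 2)))"
    proof (intro mult_mono mult_right_mono mult_left_mono)
      show "Gamma (u + N) \<le> G" using G[of "u + N"] u by auto
      have "(2 * pi) powr (u + N - 1/2) \<le> (2 * pi) powr (\<bar>b\<bar> + N)"
        using u pi_ge_two by (intro powr_mono) auto
      then show "(2 * pi * t) powr (u + N - 1/2) \<le> (2 * pi) powr (\<bar>b\<bar> + N) * t powr (u + N - 1/2)"
        using t by (subst powr_mult) (auto intro!: mult_right_mono)
    qed (use G0 t in auto)
    also have "t powr (u + N - 1/2) = t powr (u - 1/2) * t ^ N"
      using t by (simp add: powr_realpow[symmetric] powr_add[symmetric] algebra_simps)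
    finally have "norm (Gamma ?s) * t ^ N \<le> (C * t powr (u - 1/2) * exp (- (pi * t / 2))) * t ^ N"
      by (simp add: C_def mult_ac)
    then show ?thesis using t by simp
  qed
  show ?thesis
  proof (intro exI[of _ C] conjI ballI allI impI)
    show "C > 0" using G0 by (simp add: C_def)
    fix u t :: real assume u: "u \<in> {a..b}" and t: "\<bar>t\<bar> \<ge> 1"
    have "norm (Gamma (Complex u t)) = norm (Gamma (Complex u \<bar>t\<bar>))"
    proof (cases "t \<ge> 0")
      case False
      then have "Complex u t = cnj (Complex u \<bar>t\<bar>)" by (simp add: complex_eq_iff)
      then show ?thesis by (metis cnj_Gamma complex_mod_cnj)
    qed simp
    then show "norm (Gamma (Complex u t)) \<le> C * \<bar>t\<bar> powr (u - 1/2) * exp (- (pi * \<bar>t\<bar> / 2))"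
      using pos[OF u t] by simp
  qed
qed

section \<open>Contour integrals along ascending curves\<close>

text \<open>A class wide enough for both the given contours, with vertical ends, and the humps,
  whose ends are only asymptotically vertical. Parametrising the ends by height makes truncation at
  parameters -R and R a truncation at these heights.\<close>

definition ascending :: "(real \<Rightarrow> complex) \<Rightarrow> bool" where
  "ascending \<gamma> \<longleftrightarrow> (\<forall>R. \<gamma> piecewise_C1_differentiable_on {-R..R}) \<and>
    (\<exists>T M. \<forall>t. T \<le> \<bar>t\<bar> \<longrightarrow> Im (\<gamma> t) = t \<and> \<bar>Re (\<gamma> t)\<bar> \<le> M)"

lemma ascending_continuous_on:
  assumes "ascending \<gamma>"
  shows "continuous_on {-R..R} \<gamma>"
  using assms by (simp add: ascending_def piecewise_C1_differentiable_on_def)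

lemma ascending_Re_bounded_below:
  assumes "ascending \<gamma>"
  obtains r where "\<And>t. r \<le> Re (\<gamma> t)"
proof -
  obtain T M where TM: "\<And>t. T \<le> \<bar>t\<bar> \<Longrightarrow> \<bar>Re (\<gamma> t)\<bar> \<le> M"
    using assms by (auto simp: ascending_def)
  have "compact (\<gamma> ` {-T..T})"
    using assms by (intro compact_continuous_image ascending_continuous_on) auto
  then obtain B where B: "\<And>z. z \<in> \<gamma> ` {-T..T} \<Longrightarrow> norm z \<le> B"
    using compact_imp_bounded bounded_iff by metis
  show ?thesis
  proof (rule that[of "min (- M) (- B)"])
    fix t
    show "min (- M) (- B) \<le> Re (\<gamma> t)"
    proof (cases "T \<le> \<bar>t\<bar>")
      case True
      then show ?thesis using TM[of t] by linarith
    next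
      case False
      then have "norm (\<gamma> t) \<le> B" by (intro B imageI) auto
      then show ?thesis using abs_Re_le_cmod[of "\<gamma> t"] by linarith
    qed
  qed
qed

text \<open>Near a given point only a compact piece of the curve counts, because the ends leave
  every horizontal strip of bounded height. The open complement is what later turns connected
  components into path components.\<close>

lemma ascending_closed_range:
  assumes "ascending \<gamma>"
  shows "closed (range \<gamma>)"
proof -
  obtain T where T: "\<And>t. T \<le> \<bar>t\<bar> \<Longrightarrow> Im (\<gamma> t) = t"
    using assms by (auto simp: ascending_def)
  have "\<exists>U. open U \<and> z \<in> U \<and> U \<subseteq> - range \<gamma>" if z: "z \<in> - range \<gamma>" for z
  proof -
    define R where "R = max T (\<bar>Im z\<bar> + 1)"
    let ?K = "\<gamma> ` {-R..R}"
    have "compact ?K"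
      using assms by (intro compact_continuous_image ascending_continuous_on) auto
    then have "open (- ?K \<inter> {w. \<bar>Im w\<bar> < R})"
      by (intro open_Int open_Compl compact_imp_closed open_Collect_less continuous_intros) auto
    moreover have "z \<in> - ?K \<inter> {w. \<bar>Im w\<bar> < R}" using z by (auto simp: R_def)
    moreover have "- ?K \<inter> {w. \<bar>Im w\<bar> < R} \<subseteq> - range \<gamma>"
    proof safe
      fix t assume "\<gamma> t \<notin> ?K" and Im: "\<bar>Im (\<gamma> t)\<bar> < R"
      then have "\<bar>t\<bar> > R" by (metis abs_le_iff atLeastAtMost_iff imageI minus_le_iff not_le)
      then show False using T[of t] Im by (auto simp: R_def)
    qed
    ultimately show ?thesis by blast
  qed
  then show ?thesis by (simp add: closed_def open_subopen[of "- range \<gamma>"])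
qed

text \<open>Contour integrals are defined over \<open>{0..1}\<close>, the integral for J over the
  real line. The affine substitution links them: its factor b - a is the one in the derivative of
  \<open>subpath\<close>, and the finitely many corners are negligible.\<close>

lemma has_contour_integral_subpath_iff:
  assumes ab: "a < b" and pc: "\<gamma> piecewise_C1_differentiable_on {a..b}"
  shows "(f has_contour_integral I) (subpath a b \<gamma>) \<longleftrightarrow>
    ((\<lambda>t. f (\<gamma> t) * vector_derivative \<gamma> (at t)) has_integral I) {a..b}"
proof -
  obtain S where S: "finite S" "\<And>t. t \<in> {a..b} - S \<Longrightarrow> \<gamma> differentiable at t"
    using pc by (auto simp: piecewise_C1_differentiable_on_def C1_differentiable_on_eq)
  let ?h = "\<lambda>x. (b - a) * x + a"
  let ?S = "{x. ?h x \<in> S}"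
  have "finite ?S"
    using finite_vimageI[OF S(1), of ?h] ab by (auto simp: vimage_def inj_on_def)
  have "(f has_contour_integral I) (subpath a b \<gamma>) \<longleftrightarrow>
    ((\<lambda>x. f (\<gamma> (?h x)) * vector_derivative (subpath a b \<gamma>) (at x)) has_integral I) {0..1}"
    by (simp add: has_contour_integral subpath_def)
  also have "\<dots> \<longleftrightarrow> ((\<lambda>x. (b - a) *\<^sub>R (f (\<gamma> (?h x)) * vector_derivative \<gamma> (at (?h x)))) has_integral I) {0..1}"
  proof (rule has_integral_spike_finite_eq[OF \<open>finite ?S\<close>])
    fix x assume x: "x \<in> {0..1} - ?S"
    have "?h x \<le> (b - a) * 1 + a" using x ab by (intro add_right_mono mult_left_mono) auto
    also have "\<dots> = b" by simp
    finally have "?h x \<le> b" .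
    then have d: "\<gamma> differentiable at (?h x)" using x ab by (intro S(2)) auto
    have "vector_derivative (subpath a b \<gamma>) (at x) = (b - a) *\<^sub>R vector_derivative \<gamma> (at (?h x))"
    proof -
      have "(?h has_vector_derivative (b - a)) (at x)"
        by (auto intro!: derivative_eq_intros)
      then have "(\<gamma> \<circ> ?h has_vector_derivative (b - a) *\<^sub>R vector_derivative \<gamma> (at (?h x))) (at x)"
        by (intro vector_diff_chain_at) (use d vector_derivative_works in auto)
      then show ?thesis by (auto simp: subpath_def o_def intro: vector_derivative_at)
    qed
    then show "(b - a) *\<^sub>R (f (\<gamma> (?h x)) * vector_derivative \<gamma> (at (?h x)))
      = f (\<gamma> (?h x)) * vector_derivative (subpath a b \<gamma>) (at x)"
      by simp
  qed
  also have "\<dots> \<longleftrightarrow> ((\<lambda>x. f (\<gamma> (?h x)) * vector_derivative \<gamma> (at (?h x))) has_integral I /\<^sub>R (b - a)) {0..1}"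
    using ab has_integral_cmul_iff[of "b - a" "\<lambda>x. f (\<gamma> (?h x)) * vector_derivative \<gamma> (at (?h x))" "I /\<^sub>R (b - a)" "{0..1}"]
    by simp
  also have "\<dots> \<longleftrightarrow> ((\<lambda>t. f (\<gamma> t) * vector_derivative \<gamma> (at t)) has_integral I) {a..b}"
    using has_integral_affinity_iff[of "b - a" "\<lambda>t. f (\<gamma> t) * vector_derivative \<gamma> (at t)" a I a b] ab
    by simp
  finally show ?thesis .
qed

section \<open>Closing up a truncated contour, and Cauchy's theorem\<close>

lemma left_of_contour_notin_range:
  assumes "left_of_contour \<gamma> q"
  shows "q \<notin> range \<gamma>"
proof -
  obtain r where "\<And>u. Re u < r \<Longrightarrow> connected_component (- range \<gamma>) u q"
    using assms by (auto simp: left_of_contour_def)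
  from this[of "Complex (r - 1) 0"] show ?thesis
    by (auto dest: connected_component_in)
qed

text \<open>For end points \<open>a\<close>, \<open>b\<close> at heights R and -R these are three
  sides of a box. They recede in height and to the right as R grows, so they eventually miss every
  fixed compact set.\<close>

definition closing_path :: "real \<Rightarrow> complex \<Rightarrow> complex \<Rightarrow> real \<Rightarrow> complex" where
  "closing_path R a b = linepath a (Complex R R) +++ linepath (Complex R R) (Complex R (- R)) +++
     linepath (Complex R (- R)) b"

lemma Re_closed_segment_ge:
  assumes "z \<in> closed_segment a b" "r \<le> Re a" "r \<le> Re b"
  shows "r \<le> Re z"
proof -
  have "closed_segment a b \<subseteq> {z. Re z \<ge> r}"
    using assms(2,3) by (intro closed_segment_subset convex_halfspace_Re_ge) auto
  then show ?thesis using assms(1) by auto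
qed

lemma path_image_closing_path:
  assumes "z \<in> path_image (closing_path R a b)" "Im a = R" "Im b = - R"
  shows "\<bar>Im z\<bar> = \<bar>R\<bar> \<or> Re z = R" "min R (min (Re a) (Re b)) \<le> Re z"
proof -
  have z: "z \<in> closed_segment a (Complex R R) \<union> closed_segment (Complex R R) (Complex R (- R)) \<union>
      closed_segment (Complex R (- R)) b"
    using assms(1) by (auto simp: closing_path_def path_image_join)
  have "Im z = R" if "z \<in> closed_segment a (Complex R R)"
    using that assms(2) by (simp add: closed_segment_same_Im)
  moreover have "Im z = - R" if "z \<in> closed_segment (Complex R (- R)) b"
    using that assms(3) by (simp add: closed_segment_same_Im)
  moreover have "Re z = R" if "z \<in> closed_segment (Complex R R) (Complex R (- R))"
    using that by (simp add: closed_segment_same_Re)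
  ultimately show "\<bar>Im z\<bar> = \<bar>R\<bar> \<or> Re z = R" using z by auto
  show "min R (min (Re a) (Re b)) \<le> Re z"
    using z by (elim UnE) (erule Re_closed_segment_ge; simp)+
qed

text \<open>Cauchy's theorem needs winding number 0 around all of \<open>P\<close> for one and the
  same R, although \<open>P\<close> may be infinite. Points left of a lower bound \<open>r\<close>
  of Re on the curve are harmless at once, since the loop lies in the half-plane Re \<ge> r. Only
  finitely many points remain, each with its own threshold.\<close>

lemma eventually_contour_integral_closing_path:
  assumes asc: "ascending \<gamma>"
    and P: "closed P" "\<And>q. q \<in> P \<Longrightarrow> Re q \<le> c" "\<And>q. q \<in> P \<Longrightarrow> \<bar>Im q\<bar> \<le> c"
      "\<And>r. finite {q\<in>P. r \<le> Re q}"
    and left: "\<And>q. q \<in> P \<Longrightarrow> left_of_contour \<gamma> q"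
    and holo: "f holomorphic_on - P"
  shows "\<forall>\<^sub>F R in at_top.
    ((\<lambda>t. f (\<gamma> t) * vector_derivative \<gamma> (at t)) has_integral
       - contour_integral (closing_path R (\<gamma> R) (\<gamma> (- R))) f) {-R..R}"
proof -
  obtain T M where T: "\<And>t. T \<le> \<bar>t\<bar> \<Longrightarrow> Im (\<gamma> t) = t" and M: "\<And>t. T \<le> \<bar>t\<bar> \<Longrightarrow> \<bar>Re (\<gamma> t)\<bar> \<le> M"
    using asc by (auto simp: ascending_def)
  obtain r where r: "\<And>t. r \<le> Re (\<gamma> t)" using ascending_Re_bounded_below[OF asc] by metis
  define L where "L R = subpath (- R) R \<gamma> +++ closing_path R (\<gamma> R) (\<gamma> (- R))" for R
  have loop: "pathfinish (L R) = pathstart (L R)" for R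
    by (simp add: L_def closing_path_def)
  have vs: "valid_path (subpath (- R) R \<gamma>)" if "R > 0" for R
  proof -
    have "(\<lambda>x. (R - - R) * x + - R) ` {0..1} = {-R..R}"
      using that image_affinity_atLeastAtMost[of "R - - R" "- R" 0 1] by simp
    then have "(\<gamma> \<circ> (\<lambda>x. (R - - R) *\<^sub>R x + - R)) piecewise_C1_differentiable_on {0..1}"
      using asc by (intro piecewise_C1_differentiable_affine) (simp add: ascending_def)
    then show ?thesis by (simp add: valid_path_def subpath_def o_def)
  qed
  have vc: "valid_path (closing_path R a b)" for R a b
    unfolding closing_path_def by (intro valid_path_join) auto
  have vL: "valid_path (L R)" if "R > 0" for R
    unfolding L_def using vs[OF that] vc by (intro valid_path_join) (auto simp: closing_path_def)
  have image: "path_image (L R) \<subseteq> range \<gamma> \<union> path_image (closing_path R (\<gamma> R) (\<gamma> (- R)))" for R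
    unfolding L_def by (rule order_trans[OF path_image_join_subset]) (auto simp: path_image_def subpath_def)
  have low: "winding_number (L R) u = 0" if u: "Re u < r" and R: "R > 0" "T \<le> R" "r \<le> R" for u R
  proof (rule winding_number_zero_outside)
    show "path_image (L R) \<subseteq> {z. r \<le> Re z}"
    proof
      fix z assume "z \<in> path_image (L R)"
      then consider "z \<in> range \<gamma>" | "z \<in> path_image (closing_path R (\<gamma> R) (\<gamma> (- R)))"
        using image by blast
      then have "r \<le> Re z"
      proof cases
        case 2
        then have "min R (min (Re (\<gamma> R)) (Re (\<gamma> (- R)))) \<le> Re z"
          by (rule path_image_closing_path) (use T[of R] T[of "- R"] R in auto)
        then show ?thesis using r[of R] r[of "- R"] R by linarith
      qed (use r in auto)
      then show "z \<in> {z. r \<le> Re z}" by simp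
    qed
  qed (use vL[OF R(1)] loop convex_halfspace_Re_ge u in \<open>auto intro: valid_path_imp_path\<close>)
  \<comment> \<open>Lying to the left of the contour provides a path from far left to
    \<open>q\<close> that avoids the curve. Being compact, it also avoids the closing path for large
    R, so the winding number is constant along it and equals its value at the far left, which is
    0.\<close>
  have "\<exists>R0. \<forall>R\<ge>R0. winding_number (L R) q = 0" if q: "q \<in> P" for q
  proof -
    obtain r' where r': "\<And>u. Re u < r' \<Longrightarrow> connected_component (- range \<gamma>) u q"
      using left[OF q] by (auto simp: left_of_contour_def)
    define u where "u = Complex (min r r' - 1) 0"
    have "path_component (- range \<gamma>) u q"
      using r'[of u] ascending_closed_range[OF asc]
      by (subst path_component_eq_connected_component)
        (auto simp: u_def intro!: open_imp_locally_path_connected)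
    then obtain g where g: "path g" "path_image g \<subseteq> - range \<gamma>" "pathstart g = u" "pathfinish g = q"
      by (auto simp: path_component_def)
    obtain B where B: "\<And>z. z \<in> path_image g \<Longrightarrow> norm z \<le> B"
      using compact_path_image[OF g(1)] compact_imp_bounded bounded_iff by metis
    have "winding_number (L R) q = 0" if R: "R \<ge> max (max 1 T) (max r (B + 1))" for R
    proof -
      have "path (L R)" using vL[of R] R by (auto intro: valid_path_imp_path)
      moreover have "path_image g \<inter> path_image (L R) = {}"
      proof -
        have "z \<notin> path_image (closing_path R (\<gamma> R) (\<gamma> (- R)))" if "z \<in> path_image g" for z
        proof
          assume "z \<in> path_image (closing_path R (\<gamma> R) (\<gamma> (- R)))"
          then have "\<bar>Im z\<bar> = \<bar>R\<bar> \<or> Re z = R"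
            by (rule path_image_closing_path) (use T[of R] T[of "- R"] R in auto)
          then show False
            using B[OF that] R abs_Im_le_cmod[of z] abs_Re_le_cmod[of z] by linarith
        qed
        then show ?thesis using image[of R] g(2) by blast
      qed
      moreover have "u \<in> path_image g" "q \<in> path_image g"
        using g(3,4) pathstart_in_path_image pathfinish_in_path_image by metis+
      ultimately have "winding_number (L R) q = winding_number (L R) u"
        using loop g(1) by (intro winding_number_eq[where S = "path_image g"] connected_path_image)
      also have "\<dots> = 0"
        using R by (intro low) (auto simp: u_def)
      finally show ?thesis .
    qed
    then show ?thesis by blast
  qed
  then obtain R0 where R0: "\<And>q R. q \<in> P \<Longrightarrow> R0 q \<le> R \<Longrightarrow> winding_number (L R) q = 0" by metis
  \<comment> \<open>The extra element keeps the maximum meaningful when no point of \<open>P\<close>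
    lies in the half-plane.\<close>
  define R1 where "R1 = Max (insert 1 (R0 ` {q\<in>P. r \<le> Re q}))"
  have R1: "R0 q \<le> R1" if "q \<in> P" "r \<le> Re q" for q
    unfolding R1_def using P(4) that by (intro Max_ge) auto
  show ?thesis
    using eventually_ge_at_top[of "max (max 1 T) (max (max r (c + 1)) R1)"]
  proof eventually_elim
    case (elim R)
    then have R: "R > 0" "T \<le> R" "r \<le> R" "c < R" "R1 \<le> R" by auto
    have Im: "Im (\<gamma> R) = R" "Im (\<gamma> (- R)) = - R" using T[of R] T[of "- R"] R by auto
    have closing: "path_image (closing_path R (\<gamma> R) (\<gamma> (- R))) \<subseteq> - P"
    proof safe
      fix z assume "z \<in> path_image (closing_path R (\<gamma> R) (\<gamma> (- R)))" "z \<in> P"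
      then show False
        using path_image_closing_path(1)[OF _ Im, of z] P(2,3)[of z] R by auto
    qed
    have range: "range \<gamma> \<subseteq> - P" using left left_of_contour_notin_range by blast
    have "open (- P)" using P(1) by auto
    have sub: "path_image (subpath (- R) R \<gamma>) \<subseteq> range \<gamma>"
      by (auto simp: path_image_def subpath_def)
    have i1: "f contour_integrable_on subpath (- R) R \<gamma>"
      using vs[OF R(1)] range sub \<open>open (- P)\<close> by (intro contour_integrable_holomorphic_simple[OF holo]) auto
    have i2: "f contour_integrable_on closing_path R (\<gamma> R) (\<gamma> (- R))"
      using vc closing \<open>open (- P)\<close> by (intro contour_integrable_holomorphic_simple[OF holo]) auto
    have "(f has_contour_integral 0) (L R)"
    proof (rule Cauchy_theorem_global[OF \<open>open (- P)\<close> holo vL[OF R(1)] loop])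
      show "path_image (L R) \<subseteq> - P" using image closing range by blast
      fix q assume "q \<notin> - P"
      show "winding_number (L R) q = 0"
      proof (cases "r \<le> Re q")
        case True
        then show ?thesis using R1[of q] R(5) \<open>q \<notin> - P\<close> by (intro R0) auto
      next
        case False
        then show ?thesis using R by (intro low) auto
      qed
    qed
    then have "contour_integral (subpath (- R) R \<gamma>) f + contour_integral (closing_path R (\<gamma> R) (\<gamma> (- R))) f = 0"
      using i1 i2 vs[OF R(1)] vc unfolding L_def by (metis contour_integral_join contour_integral_unique)
    then have "contour_integral (subpath (- R) R \<gamma>) f = - contour_integral (closing_path R (\<gamma> R) (\<gamma> (- R))) f"
      by (simp add: add_eq_0_iff2)
    moreover have "(f has_contour_integral contour_integral (subpath (- R) R \<gamma>) f) (subpath (- R) R \<gamma>)"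
      using i1 by (rule has_contour_integral_integral)
    ultimately show ?case
      using R asc by (simp add: has_contour_integral_subpath_iff ascending_def)
  qed
qed

section \<open>Comparison of two contours\<close>

lemma tendsto_integral_symmetric_interval:
  fixes g :: "real \<Rightarrow> 'a::banach"
  assumes "g integrable_on UNIV"
  shows "((\<lambda>R. integral {-R..R} g) \<longlongrightarrow> integral UNIV g) at_top"
proof (rule tendstoI)
  fix e :: real assume "e > 0"
  then obtain B where B: "\<And>a b. ball 0 B \<subseteq> cbox a b \<Longrightarrow> norm (integral (cbox a b) g - integral UNIV g) < e"
    using integrable_integral[OF assms] unfolding has_integral_alt'[of g] by (simp cong: if_cong) blast
  show "\<forall>\<^sub>F R in at_top. dist (integral {-R..R} g) (integral UNIV g) < e"
    using eventually_ge_at_top[of B]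
  proof eventually_elim
    case (elim R)
    then have "ball 0 B \<subseteq> cbox (-R) R" by (auto simp: ball_def)
    from B[OF this] show ?case by (simp add: dist_norm)
  qed
qed

lemma tendsto_0_if_norm_le:
  assumes "\<And>e. e > 0 \<Longrightarrow> \<forall>\<^sub>F x in F. norm (f x) \<le> e"
  shows "(f \<longlongrightarrow> 0) F"
proof (rule tendstoI)
  fix e :: real assume "e > 0"
  then have "\<forall>\<^sub>F x in F. norm (f x) \<le> e / 2" by (intro assms) simp
  then show "\<forall>\<^sub>F x in F. dist (f x) 0 < e"
    by eventually_elim (use \<open>e > 0\<close> in simp)
qed

text \<open>Cauchy's theorem for a triangle. It serves for three points on a horizontal line, where
  the triangle degenerates to a segment and their order does not matter.\<close>

lemma contour_integral_linepath_collinear: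
  assumes "f holomorphic_on convex hull {a, b, c}"
  shows "contour_integral (linepath a b) f + contour_integral (linepath b c) f = contour_integral (linepath a c) f"
proof -
  have cont: "continuous_on (closed_segment x y) f" if "x \<in> {a, b, c}" "y \<in> {a, b, c}" for x y
  proof -
    have "closed_segment x y \<subseteq> convex hull {a, b, c}"
      using that by (intro closed_segment_subset convex_convex_hull) (auto intro: hull_inc)
    then show ?thesis
      using assms by (blast intro: holomorphic_on_imp_continuous_on holomorphic_on_subset)
  qed
  then have "f contour_integrable_on linepath x y" if "x \<in> {a, b, c}" "y \<in> {a, b, c}" for x y
    using that by (intro contour_integrable_continuous_linepath)
  moreover have "contour_integral (linepath a b +++ linepath b c +++ linepath c a) f = 0"
    using Cauchy_theorem_triangle[OF assms] by (rule contour_integral_unique)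
  ultimately have "contour_integral (linepath a b) f + (contour_integral (linepath b c) f + contour_integral (linepath c a) f) = 0"
    by simp
  moreover have "contour_integral (linepath c a) f = - contour_integral (linepath a c) f"
    by (intro contour_integral_reverse_linepath cont) auto
  ultimately show ?thesis by (simp add: algebra_simps add_eq_0_iff2)
qed

text \<open>The vertical sides cancel, and the horizontal sides differ by the segments between the
  end points. Thus the integral along Re s = R, where no smallness is available, is never
  estimated.\<close>

lemma contour_integral_closing_path_diff:
  assumes holo: "f holomorphic_on S"
    and S: "\<And>z. \<bar>Im z\<bar> = \<bar>R\<bar> \<or> Re z = R \<Longrightarrow> z \<in> S"
    and Im: "Im a = R" "Im a' = R" "Im b = - R" "Im b' = - R"
  shows "contour_integral (closing_path R a b) f - contour_integral (closing_path R a' b') f =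
    contour_integral (linepath a a') f + contour_integral (linepath b' b) f"
proof -
  have int: "f contour_integrable_on linepath x y" if "closed_segment x y \<subseteq> S" for x y
    using that holo by (intro contour_integrable_continuous_linepath)
        (blast intro: holomorphic_on_imp_continuous_on holomorphic_on_subset)
  have seg: "closed_segment a (Complex R R) \<subseteq> S" "closed_segment (Complex R R) (Complex R (- R)) \<subseteq> S"
      "closed_segment (Complex R (- R)) b \<subseteq> S" if "Im a = R" "Im b = - R" for a b
    using that S by (auto simp: closed_segment_same_Im closed_segment_same_Re)
  have split: "contour_integral (closing_path R a b) f = contour_integral (linepath a (Complex R R)) f +
      (contour_integral (linepath (Complex R R) (Complex R (- R))) f + contour_integral (linepath (Complex R (- R)) b) f)"
    if "Im a = R" "Im b = - R" for a b
    unfolding closing_path_def using seg[OF that] by (simp add: int)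
  have hull: "f holomorphic_on convex hull {x, y, z}" if "Im x = h" "Im y = h" "Im z = h" "\<bar>h\<bar> = \<bar>R\<bar>" for x y z h
  proof -
    have "convex hull {x, y, z} \<subseteq> {z. Im z = h}"
      using that convex_hyperplane[of \<i> h] by (intro hull_minimal) auto
    then show ?thesis using S that(4) by (intro holomorphic_on_subset[OF holo]) auto
  qed
  have "contour_integral (linepath a a') f + contour_integral (linepath a' (Complex R R)) f
      = contour_integral (linepath a (Complex R R)) f"
    using Im by (intro contour_integral_linepath_collinear hull[of _ R]) auto
  moreover have "contour_integral (linepath (Complex R (- R)) b') f + contour_integral (linepath b' b) f
      = contour_integral (linepath (Complex R (- R)) b) f"
    using Im by (intro contour_integral_linepath_collinear hull[of _ "- R"]) auto
  ultimately show ?thesis using Im by (simp add: split algebra_simps)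
qed

text \<open>Truncated at height R, the two integrals differ by two horizontal segments of length at
  most b - a, on which \<open>decay\<close> makes f uniformly small.\<close>

theorem integral_along_ascending_eq:
  assumes asc: "ascending \<gamma>" "ascending \<gamma>'"
    and P: "closed P" "\<And>q. q \<in> P \<Longrightarrow> Re q \<le> c" "\<And>q. q \<in> P \<Longrightarrow> \<bar>Im q\<bar> \<le> c"
      "\<And>r. finite {q\<in>P. r \<le> Re q}"
    and left: "\<forall>q\<in>P. left_of_contour \<gamma> q" "\<forall>q\<in>P. left_of_contour \<gamma>' q"
    and holo: "f holomorphic_on - P"
    and strip: "\<forall>\<^sub>F t in at_infinity. Re (\<gamma> t) \<in> {a..b}" "\<forall>\<^sub>F t in at_infinity. Re (\<gamma>' t) \<in> {a..b}"
    and decay: "\<And>e. e > 0 \<Longrightarrow> \<exists>T. \<forall>z. Re z \<in> {a..b} \<and> T \<le> \<bar>Im z\<bar> \<longrightarrow> norm (f z) \<le> e"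
    and int: "(\<lambda>t. f (\<gamma> t) * vector_derivative \<gamma> (at t)) integrable_on UNIV"
      "(\<lambda>t. f (\<gamma>' t) * vector_derivative \<gamma>' (at t)) integrable_on UNIV"
  shows "integral UNIV (\<lambda>t. f (\<gamma> t) * vector_derivative \<gamma> (at t)) =
    integral UNIV (\<lambda>t. f (\<gamma>' t) * vector_derivative \<gamma>' (at t))"
proof -
  let ?g = "\<lambda>t. f (\<gamma> t) * vector_derivative \<gamma> (at t)"
  let ?g' = "\<lambda>t. f (\<gamma>' t) * vector_derivative \<gamma>' (at t)"
  obtain T where T: "\<And>t. T \<le> \<bar>t\<bar> \<Longrightarrow> Im (\<gamma> t) = t"
    using asc(1) by (auto simp: ascending_def)
  obtain T' where T': "\<And>t. T' \<le> \<bar>t\<bar> \<Longrightarrow> Im (\<gamma>' t) = t"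
    using asc(2) by (auto simp: ascending_def)
  obtain B where B: "\<And>t. B \<le> \<bar>t\<bar> \<Longrightarrow> Re (\<gamma> t) \<in> {a..b} \<and> Re (\<gamma>' t) \<in> {a..b}"
    using eventually_conj[OF strip] unfolding eventually_at_infinity real_norm_def by blast
  have closing: "\<forall>\<^sub>F R in at_top.
      ((\<lambda>t. f (\<gamma> t) * vector_derivative \<gamma> (at t)) has_integral
         - contour_integral (closing_path R (\<gamma> R) (\<gamma> (- R))) f) {-R..R}"
    if "ascending \<gamma>" "\<forall>q\<in>P. left_of_contour \<gamma> q" for \<gamma>
    by (rule eventually_contour_integral_closing_path[where c = c and P = P])
      (use that P holo in auto)
  define K where "K = b - a"
  have K: "K \<ge> 0" using B[OF abs_ge_self] by (auto simp: K_def)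
  have "((\<lambda>R. integral {-R..R} ?g - integral {-R..R} ?g') \<longlongrightarrow> 0) at_top"
  proof (rule tendsto_0_if_norm_le)
    fix e :: real assume "e > 0"
    \<comment> \<open>Two segments of length at most \<open>K\<close>; the added 1 admits a strip of
      width 0.\<close>
    define e' where "e' = e / (2 * (K + 1))"
    have "e' > 0" using \<open>e > 0\<close> K by (simp add: e'_def)
    then obtain U where U: "\<And>z. Re z \<in> {a..b} \<Longrightarrow> U \<le> \<bar>Im z\<bar> \<Longrightarrow> norm (f z) \<le> e'"
      using decay by metis
    have bound: "norm (contour_integral (linepath x y) f) \<le> e' * K"
      if xy: "Re x \<in> {a..b}" "Re y \<in> {a..b}" "Im x = Im y" "max U (c + 1) \<le> \<bar>Im x\<bar>" for x y
    proof -
      have Im: "Im z = Im x" "Re z \<in> {a..b}" if "z \<in> closed_segment x y" for z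
        using that xy by (auto simp: closed_segment_same_Im closed_segment_eq_real_ivl split: if_splits)
      have "z \<notin> P" if "z \<in> closed_segment x y" for z
        using P(3)[of z] xy(4) Im(1)[OF that] by linarith
      then have "closed_segment x y \<subseteq> - P" by blast
      then have "f contour_integrable_on linepath x y"
        by (intro contour_integrable_continuous_linepath)
          (blast intro: holomorphic_on_imp_continuous_on holomorphic_on_subset[OF holo])
      then have "norm (contour_integral (linepath x y) f) \<le> e' * norm (y - x)"
      proof (rule contour_integral_bound_linepath)
        fix z assume "z \<in> closed_segment x y"
        from Im[OF this] show "norm (f z) \<le> e'" using xy by (intro U) auto
      qed (use \<open>e' > 0\<close> in auto)
      also have "norm (y - x) \<le> K"
        using cmod_le[of "y - x"] xy by (auto simp: K_def)
      finally show ?thesis using \<open>e' > 0\<close> by (simp add: mult_left_mono)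
    qed
    show "\<forall>\<^sub>F R in at_top. norm (integral {-R..R} ?g - integral {-R..R} ?g') \<le> e"
      using closing[OF asc(1) left(1)] closing[OF asc(2) left(2)]
        eventually_ge_at_top[of "max (max 1 (max T T')) (max (max U B) (c + 1))"]
    proof eventually_elim
      case (elim R)
      then have R: "R \<ge> 1" "R \<ge> T" "R \<ge> T'" "R \<ge> U" "R \<ge> B" "R \<ge> c + 1" by auto
      have Im: "Im (\<gamma> R) = R" "Im (\<gamma>' R) = R" "Im (\<gamma> (- R)) = - R" "Im (\<gamma>' (- R)) = - R"
        using R T T' by auto
      have Re: "Re (\<gamma> R) \<in> {a..b}" "Re (\<gamma>' R) \<in> {a..b}" "Re (\<gamma> (- R)) \<in> {a..b}" "Re (\<gamma>' (- R)) \<in> {a..b}"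
        using R B[of R] B[of "- R"] by auto
      have "integral {-R..R} ?g - integral {-R..R} ?g' =
          - (contour_integral (closing_path R (\<gamma> R) (\<gamma> (- R))) f
            - contour_integral (closing_path R (\<gamma>' R) (\<gamma>' (- R))) f)"
        using elim(1,2) by (simp add: integral_unique)
      also have "\<dots> = - (contour_integral (linepath (\<gamma> R) (\<gamma>' R)) f + contour_integral (linepath (\<gamma>' (- R)) (\<gamma> (- R))) f)"
      proof (subst contour_integral_closing_path_diff[OF holo])
        fix z assume "\<bar>Im z\<bar> = \<bar>R\<bar> \<or> Re z = R"
        then show "z \<in> - P" using P(2,3)[of z] R by auto
      qed (use Im in auto)
      also have "norm \<dots> \<le> e' * K + e' * K"
        unfolding norm_minus_cancel using Im Re R
        by (intro order_trans[OF norm_triangle_ineq] add_mono bound) auto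
      also have "\<dots> \<le> e"
      proof -
        have "e = e' * (2 * (K + 1))" using K by (simp add: e'_def)
        then show ?thesis using \<open>e' > 0\<close> by (simp add: algebra_simps)
      qed
      finally show ?case .
    qed
  qed
  moreover have "((\<lambda>R. integral {-R..R} ?g - integral {-R..R} ?g') \<longlongrightarrow> integral UNIV ?g - integral UNIV ?g') at_top"
    using int by (intro tendsto_diff tendsto_integral_symmetric_interval)
  ultimately have "integral UNIV ?g - integral UNIV ?g' = 0"
    using tendsto_unique[OF trivial_limit_at_top_linorder] by blast
  then show ?thesis by simp
qed

section \<open>Differentiation under the integral sign\<close>

text \<open>The middle part is a separate assumption because the integrand may jump at corners of a
  contour. On the ends continuity supplies measurability, and the power bound a dominating
  function.\<close>

lemma integrable_on_UNIV_if_power_decay: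
  fixes g :: "real \<Rightarrow> 'a::euclidean_space"
  assumes mid: "g integrable_on {-T..T}" and T: "T > 0" and e: "e < -1"
    and cont: "continuous_on {T..} g" "continuous_on {..-T} g"
    and bound: "\<And>t. T \<le> \<bar>t\<bar> \<Longrightarrow> norm (g t) \<le> C * \<bar>t\<bar> powr e"
  shows "g integrable_on UNIV"
proof -
  have powr: "(\<lambda>t. C * t powr e) integrable_on {T..}"
    using has_integral_mult_right[OF has_integral_powr_to_inf[OF e T]] by blast
  have right: "g integrable_on {T..}"
  proof (rule measurable_bounded_by_integrable_imp_integrable[OF _ powr])
    show "norm (g t) \<le> C * t powr e" if "t \<in> {T..}" for t
      using bound[of t] that T by auto
  qed (auto intro!: continuous_imp_measurable_on_sets_lebesgue cont)
  have "(\<lambda>t. C * (- t) powr e) absolutely_integrable_on {..-T}"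
  proof -
    have "(\<lambda>t. t powr e) absolutely_integrable_on {T..}"
      using has_integral_powr_to_inf[OF e T] by (intro nonnegative_absolutely_integrable_1) auto
    then have "(\<lambda>t. (- t) powr e) absolutely_integrable_on {..-T}"
      using has_absolute_integral_reflect_real[of "{..-T}" "{T..}" "\<lambda>t. t powr e"] by auto
    then show ?thesis by (rule set_integrable_mult_right)
  qed
  then have "(\<lambda>t. C * (- t) powr e) integrable_on {..-T}"
    by (rule set_lebesgue_integral_eq_integral)
  then have left: "g integrable_on {..-T}"
  proof (rule measurable_bounded_by_integrable_imp_integrable[rotated])
    show "norm (g t) \<le> C * (- t) powr e" if "t \<in> {..-T}" for t
      using bound[of t] that T by auto
  qed (auto intro!: continuous_imp_measurable_on_sets_lebesgue cont)
  have "g integrable_on {..-T} \<union> {-T..T}"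
    using left mid by (rule integrable_Un[rotated]) (use T in auto)
  moreover have "negligible (({..-T} \<union> {-T..T}) \<inter> {T..})"
    using T by (intro negligible_subset[OF negligible_finite[of "{-T, T}"]]) auto
  ultimately have "g integrable_on ({..-T} \<union> {-T..T}) \<union> {T..}"
    using right by (metis integrable_Un)
  moreover have "({..-T} \<union> {-T..T}) \<union> {T..} = UNIV" by auto
  ultimately show ?thesis by simp
qed

lemma integrable_on_UNIV_if_dominated:
  fixes g :: "real \<Rightarrow> 'a::euclidean_space"
  assumes "continuous_on UNIV g" "h integrable_on UNIV" "\<And>t. norm (g t) \<le> c * h t"
  shows "g integrable_on UNIV"
proof (rule measurable_bounded_by_integrable_imp_integrable)
  show "(\<lambda>t. c * h t) integrable_on UNIV" using assms(2) by (rule integrable_on_mult_right)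
qed (use assms in \<open>auto intro: continuous_imp_measurable_on_sets_lebesgue\<close>)

text \<open>The extra weight \<open>1 + |z|\<close> pays for the quadratic Taylor remainder of the exponential, so no
  dominated convergence is needed.\<close>

lemma has_vector_derivative_integral_exp:
  fixes G z :: "real \<Rightarrow> complex"
  assumes cont: "continuous_on UNIV G" "continuous_on UNIV z"
    and Re: "\<And>t. \<bar>Re (z t)\<bar> \<le> M"
    and h: "h integrable_on UNIV" "\<And>t. norm (G t) * (1 + norm (z t))\<^sup>2 \<le> h t"
  shows "((\<lambda>u. integral UNIV (\<lambda>t. G t * exp (z t * of_real u))) has_vector_derivative
    integral UNIV (\<lambda>t. G t * z t * exp (z t * of_real u))) (at u)"
proof -
  define A where "A = exp (M * (\<bar>u\<bar> + 1))"
  have M: "M \<ge> 0" using Re[of 0] by linarith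
  have exp_le: "norm (exp (z t * of_real v)) \<le> A" if "\<bar>v\<bar> \<le> \<bar>u\<bar> + 1" for t v
  proof -
    have "Re (z t) * v \<le> \<bar>Re (z t)\<bar> * \<bar>v\<bar>" by (metis abs_ge_self abs_mult)
    also have "\<dots> \<le> M * (\<bar>u\<bar> + 1)" using Re that M by (intro mult_mono) auto
    finally show ?thesis by (simp add: A_def)
  qed
  have h0: "h t \<ge> 0" for t using h(2)[of t] by (rule order_trans[rotated]) simp
  have w: "norm (G t) \<le> h t" "norm (G t) * norm (z t) \<le> h t" "norm (G t) * (norm (z t))\<^sup>2 \<le> h t" for t
  proof -
    have le: "norm (G t) * a \<le> h t" if "a \<le> (1 + norm (z t))\<^sup>2" for a
      using mult_left_mono[OF that, of "norm (G t)"] h(2)[of t] by simp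
    have "1 \<le> (1 + norm (z t))\<^sup>2" "norm (z t) \<le> (1 + norm (z t))\<^sup>2" "(norm (z t))\<^sup>2 \<le> (1 + norm (z t))\<^sup>2"
      by (auto simp: power2_eq_square algebra_simps)
    from this[THEN le]
    show "norm (G t) \<le> h t" "norm (G t) * norm (z t) \<le> h t" "norm (G t) * (norm (z t))\<^sup>2 \<le> h t"
      by simp_all
  qed
  have int0: "(\<lambda>t. G t * exp (z t * of_real v)) integrable_on UNIV" if "\<bar>v\<bar> \<le> \<bar>u\<bar> + 1" for v
  proof (rule integrable_on_UNIV_if_dominated[OF _ h(1)])
    show "norm (G t * exp (z t * of_real v)) \<le> A * h t" for t
      using mult_mono[OF exp_le[OF that, of t] w(1)[of t]] h0[of t] by (simp add: norm_mult A_def mult_ac)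
  qed (intro continuous_intros cont)
  have int1: "(\<lambda>t. G t * z t * exp (z t * of_real u)) integrable_on UNIV"
  proof (rule integrable_on_UNIV_if_dominated[OF _ h(1)])
    show "norm (G t * z t * exp (z t * of_real u)) \<le> A * h t" for t
      using mult_mono[OF exp_le[of u t] w(2)[of t]] h0[of t] by (simp add: norm_mult A_def mult_ac)
  qed (intro continuous_intros cont)
  define B where "B = A * exp M * integral UNIV h"
  let ?F = "\<lambda>u. integral UNIV (\<lambda>t. G t * exp (z t * of_real u))"
  let ?D = "integral UNIV (\<lambda>t. G t * z t * exp (z t * of_real u))"
  have remainder: "norm (?F (u + v) - ?F u - v *\<^sub>R ?D) \<le> B * v\<^sup>2" if v: "\<bar>v\<bar> \<le> 1" for v
  proof -
    \<comment> \<open>The error of the linear approximation is again a single integral, whose last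
      factor is at most exp(M) |z|^2 v^2 for |v| \<le> 1. The weight absorbs |z|^2, leaving a
      quadratic error in v.\<close>
    let ?r = "\<lambda>t. G t * exp (z t * of_real u) * (exp (z t * of_real v) - 1 - z t * of_real v)"
    have r: "?r t = G t * exp (z t * of_real (u + v)) - G t * exp (z t * of_real u) - v *\<^sub>R (G t * z t * exp (z t * of_real u))" for t
      by (simp add: algebra_simps exp_add scaleR_conv_of_real)
    have "(?r has_integral ?F (u + v) - ?F u - v *\<^sub>R ?D) UNIV"
      unfolding r using v int1
      by (intro has_integral_diff has_integral_cmul integrable_integral int0) auto
    then have "norm (?F (u + v) - ?F u - v *\<^sub>R ?D) = norm (integral UNIV ?r)" and int: "?r integrable_on UNIV"
      by (auto simp: integral_unique)
    note this(1)
    also have "norm (integral UNIV ?r) \<le> integral UNIV (\<lambda>t. A * exp M * v\<^sup>2 * h t)"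
    proof (rule integral_norm_bound_integral[OF int])
      show "(\<lambda>t. A * exp M * v\<^sup>2 * h t) integrable_on UNIV" using h(1) by (rule integrable_on_mult_right)
      fix t
      have "norm (exp (z t * of_real v) - 1 - z t * of_real v) \<le> exp \<bar>Re (z t) * v\<bar> * (norm (z t) * \<bar>v\<bar>)\<^sup>2"
        using Taylor_exp[of "z t * of_real v" 1] by (simp add: norm_mult power2_eq_square algebra_simps)
      also have "\<bar>Re (z t) * v\<bar> \<le> M * 1"
        unfolding abs_mult using Re[of t] v M by (intro mult_mono) auto
      finally have T: "norm (exp (z t * of_real v) - 1 - z t * of_real v) \<le> exp M * ((norm (z t))\<^sup>2 * v\<^sup>2)"
        by (simp add: power_mult_distrib mult_right_mono)
      have "norm (?r t) \<le> norm (G t) * A * (exp M * ((norm (z t))\<^sup>2 * v\<^sup>2))"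
        unfolding norm_mult by (intro mult_mono exp_le T) (auto simp: A_def)
      also have "\<dots> = A * exp M * v\<^sup>2 * (norm (G t) * (norm (z t))\<^sup>2)" by (simp add: mult_ac)
      also have "\<dots> \<le> A * exp M * v\<^sup>2 * h t"
        by (intro mult_left_mono w) (auto simp: A_def)
      finally show "norm (?r t) \<le> A * exp M * v\<^sup>2 * h t" .
    qed
    also have "\<dots> = B * v\<^sup>2" by (simp add: B_def mult_ac)
    finally show ?thesis .
  qed
  have "((\<lambda>v. (?F (u + v) - ?F u - v *\<^sub>R ?D) /\<^sub>R norm v) \<longlongrightarrow> 0) (at 0)"
  proof (rule Lim_null_comparison)
    show "\<forall>\<^sub>F v in at 0. norm ((?F (u + v) - ?F u - v *\<^sub>R ?D) /\<^sub>R norm v) \<le> \<bar>B\<bar> * \<bar>v\<bar>"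
      unfolding eventually_at
    proof (intro exI[of _ 1] conjI ballI impI)
      fix v :: real assume v: "v \<noteq> 0 \<and> dist v 0 < 1"
      define X where "X = ?F (u + v) - ?F u - v *\<^sub>R ?D"
      have "norm X \<le> \<bar>B\<bar> * v\<^sup>2"
        unfolding X_def
      proof (intro order_trans[OF remainder] mult_right_mono)
        show "\<bar>v\<bar> \<le> 1" using v by simp
      qed auto
      then have "norm (X /\<^sub>R norm v) \<le> \<bar>B\<bar> * \<bar>v\<bar>"
        using v by (simp add: divide_simps power2_eq_square abs_mult_self_eq mult.assoc flip: abs_mult)
      then show "norm ((?F (u + v) - ?F u - v *\<^sub>R ?D) /\<^sub>R norm v) \<le> \<bar>B\<bar> * \<bar>v\<bar>"
        unfolding X_def .
    qed simp
    show "((\<lambda>v. \<bar>B\<bar> * \<bar>v\<bar>) \<longlongrightarrow> 0) (at 0)"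
      by (intro tendsto_mult_right_zero tendsto_rabs_zero tendsto_ident_at)
  qed
  from tendsto_norm_zero[OF this]
  have "((\<lambda>v. norm (?F (u + v) - ?F u - v *\<^sub>R ?D) / norm v) \<longlongrightarrow> 0) (at 0)"
    by (simp add: divide_inverse_commute)
  then show ?thesis
    unfolding has_vector_derivative_def has_derivative_at
    by (auto intro: bounded_linear_scaleR_left)
qed

text \<open>The factor 1/x of the chain rule becomes a shift of the exponent by -1. The derivative
  thus has the same shape as the integral itself, which allows iteration.\<close>

lemma has_vector_derivative_integral_exp_ln:
  fixes G z :: "real \<Rightarrow> complex"
  assumes cont: "continuous_on UNIV G" "continuous_on UNIV z"
    and Re: "\<And>t. \<bar>Re (z t)\<bar> \<le> M"
    and h: "h integrable_on UNIV" "\<And>t. norm (G t) * (1 + norm (z t))\<^sup>2 \<le> h t"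
    and x: "x > 0"
  shows "((\<lambda>x. integral UNIV (\<lambda>t. G t * exp (z t * of_real (ln x)))) has_vector_derivative
    integral UNIV (\<lambda>t. G t * z t * exp ((z t - 1) * of_real (ln x)))) (at x)"
proof -
  have "(ln has_vector_derivative 1 / x) (at x)"
    using x by (auto intro!: derivative_eq_intros simp flip: has_real_derivative_iff_has_vector_derivative)
  from vector_diff_chain_at[OF this has_vector_derivative_integral_exp[OF cont Re h]]
  have "((\<lambda>x. integral UNIV (\<lambda>t. G t * exp (z t * of_real (ln x)))) has_vector_derivative
    (1 / x) *\<^sub>R integral UNIV (\<lambda>t. G t * z t * exp (z t * of_real (ln x)))) (at x)"
    by (simp add: o_def)
  also have "(1 / x) *\<^sub>R integral UNIV (\<lambda>t. G t * z t * exp (z t * of_real (ln x)))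
    = integral UNIV (\<lambda>t. (1 / x) *\<^sub>R (G t * z t * exp (z t * of_real (ln x))))"
    by (rule integral_cmul[symmetric])
  also have "(\<lambda>t. (1 / x) *\<^sub>R (G t * z t * exp (z t * of_real (ln x)))) =
      (\<lambda>t. G t * z t * exp ((z t - 1) * of_real (ln x)))"
    using x by (simp add: algebra_simps exp_diff exp_of_real scaleR_conv_of_real field_simps fun_eq_iff)
  finally show ?thesis .
qed

text \<open>The coefficient in (d/dx)^j x^z = \<open>falling j z\<close> x^(z - j).\<close>

definition falling :: "nat \<Rightarrow> complex \<Rightarrow> complex" where
  "falling j z = (\<Prod>i<j. z - of_nat i)"

lemma falling_Suc: "falling (Suc j) z = falling j z * (z - of_nat j)"
  by (simp add: falling_def)

lemma norm_falling_le: "norm (falling j z) \<le> (real (Suc j) * (1 + norm z)) ^ j"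
proof -
  have "norm (falling j z) \<le> (\<Prod>i<j. real (Suc j) * (1 + norm z))"
    unfolding falling_def prod_norm[symmetric]
  proof (intro prod_mono conjI)
    fix i assume i: "i \<in> {..<j}"
    have "norm (z - of_nat i) \<le> norm z + real i" using norm_triangle_ineq4[of z "of_nat i"] by simp
    also have "\<dots> \<le> norm z + real j" using i by simp
    also have "\<dots> \<le> norm z + real j + (1 + real j * norm z)" by simp
    also have "\<dots> = real (Suc j) * (1 + norm z)" by (simp add: algebra_simps)
    finally show "norm (z - of_nat i) \<le> real (Suc j) * (1 + norm z)" .
  qed simp
  then show ?thesis by simp
qed

lemma continuous_on_falling [continuous_intros]:
  "continuous_on S f \<Longrightarrow> continuous_on S (\<lambda>t. falling j (f t))"
  unfolding falling_def by (intro continuous_intros)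

text \<open>Passing from the derivative of order j to the next uses j powers of 1 + |z| for
  \<open>falling\<close> and two for the differentiation; j < n gives j + 2 \<le> n + 1, the weight
  in \<open>int\<close>. As \<open>w\<close> is prescribed for positive arguments only, derivatives
  are transferred on an open half-line.\<close>

lemma iter_deriv_integral_exp_ln:
  fixes G z :: "real \<Rightarrow> complex"
  assumes cont: "continuous_on UNIV G" "continuous_on UNIV z"
    and Re: "\<And>t. \<bar>Re (z t)\<bar> \<le> M"
    and int: "(\<lambda>t. norm (G t) * (1 + norm (z t)) ^ (n + 1)) integrable_on UNIV"
    and w: "\<And>x. x > 0 \<Longrightarrow> w x = integral UNIV (\<lambda>t. G t * exp (z t * of_real (ln x)))"
  shows "j \<le> n \<Longrightarrow> x > 0 \<Longrightarrow>
      iter_deriv j w x = integral UNIV (\<lambda>t. G t * falling j (z t) * exp ((z t - of_nat j) * of_real (ln x)))"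
    and "j < n \<Longrightarrow> x > 0 \<Longrightarrow> iter_deriv j w differentiable (at x)"
proof -
  let ?U = "\<lambda>j x. integral UNIV (\<lambda>t. G t * falling j (z t) * exp ((z t - of_nat j) * of_real (ln x)))"
  have step: "(?U j has_vector_derivative ?U (Suc j) x) (at x)" if j: "j < n" and x: "x > 0" for j x
  proof -
    let ?c = "real (Suc j) ^ j * (real (Suc j))\<^sup>2"
    have "((\<lambda>x. integral UNIV (\<lambda>t. (G t * falling j (z t)) * exp ((z t - of_nat j) * of_real (ln x)))) has_vector_derivative
       integral UNIV (\<lambda>t. (G t * falling j (z t)) * (z t - of_nat j) * exp ((z t - of_nat j - 1) * of_real (ln x)))) (at x)"
    proof (rule has_vector_derivative_integral_exp_ln)
      show "(\<lambda>t. ?c * (norm (G t) * (1 + norm (z t)) ^ (n + 1))) integrable_on UNIV"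
        using int by (rule integrable_on_mult_right)
      fix t
      show "\<bar>Re (z t - of_nat j)\<bar> \<le> M + j" using Re[of t] by simp
      have "1 + norm (z t - of_nat j) \<le> 1 + norm (z t) + real j + real j * norm (z t)"
        using norm_triangle_ineq4[of "z t" "of_nat j"] by (simp add: add_increasing2)
      also have "\<dots> = real (Suc j) * (1 + norm (z t))" by (simp add: algebra_simps)
      finally have "norm (G t * falling j (z t)) * (1 + norm (z t - of_nat j))\<^sup>2 \<le>
          norm (G t) * (real (Suc j) * (1 + norm (z t))) ^ j * (real (Suc j) * (1 + norm (z t)))\<^sup>2"
        unfolding norm_mult by (intro mult_mono power_mono mult_left_mono norm_falling_le) auto
      also have "\<dots> = ?c * (norm (G t) * (1 + norm (z t)) ^ (j + 2))"
        by (simp only: power_mult_distrib power_add mult_ac)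
      also have "\<dots> \<le> ?c * (norm (G t) * (1 + norm (z t)) ^ (n + 1))"
        using j by (intro mult_left_mono power_increasing) auto
      finally show "norm (G t * falling j (z t)) * (1 + norm (z t - of_nat j))\<^sup>2
        \<le> ?c * (norm (G t) * (1 + norm (z t)) ^ (n + 1))" .
    qed (use x in \<open>auto intro!: continuous_intros cont\<close>)
    then show ?thesis by (simp add: falling_Suc algebra_simps)
  qed
  have eq: "iter_deriv j w x = ?U j x" if "j \<le> n" "x > 0" for j x
    using that
  proof (induction j arbitrary: x)
    case 0
    then show ?case by (simp add: iter_deriv_def falling_def w)
  next
    case (Suc j)
    have "(iter_deriv j w has_vector_derivative ?U (Suc j) x) (at x)"
    proof (rule has_vector_derivative_transform_within_open[OF step[of j x], of "{0<..}"])
      show "?U j y = iter_deriv j w y" if "y \<in> {0<..}" for y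
        using Suc that by simp
    qed (use Suc in auto)
    then show ?case by (simp add: iter_deriv_def vector_derivative_at)
  qed
  show "j \<le> n \<Longrightarrow> x > 0 \<Longrightarrow> iter_deriv j w x = ?U j x" by (rule eq)
  show "iter_deriv j w differentiable (at x)" if "j < n" "x > 0"
  proof -
    have "(iter_deriv j w has_vector_derivative ?U (Suc j) x) (at x)"
    proof (rule has_vector_derivative_transform_within_open[OF step[of j x], of "{0<..}"])
      show "?U j y = iter_deriv j w y" if "y \<in> {0<..}" for y
        using eq[of j y] that \<open>j < n\<close> by simp
    qed (use that in auto)
    then show ?thesis by (auto simp: has_vector_derivative_def differentiable_def)
  qed
qed

section \<open>Stirling numbers and the Euler operator\<close>

text \<open>With k = j + m the recursion reads S(k, j) = j S(k-1, j) + S(k-1, j-1), so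
  \<open>coeffA j m\<close> is the Stirling number S(j + m, j). The induction rests on z (z)_j =
  (z)_(j+1) + j (z)_j for falling factorials.\<close>

lemma sum_coeffA_falling: "(\<Sum>j\<le>k. of_int (coeffA (int j) (int k - int j)) * falling j z) = z ^ k"
proof (induction k)
  case 0
  show ?case by (simp add: coeffA.simps[of 0 0] coeffA.simps[of 0 "-1"] coeffA.simps[of "-1" 0] falling_def)
next
  case (Suc k)
  \<comment> \<open>The boundary values settle the two ends of the sums: m = -1 removes the surplus
    term j = k + 1, and j = 0 contributes nothing to a positive power of z.\<close>
  have z: "coeffA (int k + 1) (- 1) = 0" by (simp add: coeffA.simps)
  have zero: "coeffA 0 (int (Suc k)) = 0"
  proof -
    have "coeffA (- 1) (int (Suc k)) = 0" by (subst coeffA.simps) simp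
    then show ?thesis by (subst coeffA.simps) simp
  qed
  have rec: "coeffA (int (Suc j)) (int (Suc k) - int (Suc j)) =
      int (Suc j) * coeffA (int (Suc j)) (int k - int (Suc j)) + coeffA (int j) (int k - int j)" if "j \<le> k" for j
    using that by (subst coeffA.simps) (simp add: algebra_simps)
  have "(\<Sum>j\<le>Suc k. of_int (coeffA (int j) (int (Suc k) - int j)) * falling j z)
    = (\<Sum>j\<le>k. of_int (coeffA (int (Suc j)) (int (Suc k) - int (Suc j))) * falling (Suc j) z)"
    by (subst sum.atMost_Suc_shift) (use zero in simp)
  also have "\<dots> = (\<Sum>j\<le>k. of_nat (Suc j) * of_int (coeffA (int (Suc j)) (int k - int (Suc j))) * falling (Suc j) z)
      + (\<Sum>j\<le>k. of_int (coeffA (int j) (int k - int j)) * falling (Suc j) z)"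
    unfolding sum.distrib[symmetric]
  proof (intro sum.cong refl)
    fix j assume "j \<in> {..k}"
    then have "j \<le> k" by simp
    show "of_int (coeffA (int (Suc j)) (int (Suc k) - int (Suc j))) * falling (Suc j) z =
        of_nat (Suc j) * of_int (coeffA (int (Suc j)) (int k - int (Suc j))) * falling (Suc j) z +
        of_int (coeffA (int j) (int k - int j)) * falling (Suc j) z"
      unfolding rec[OF \<open>j \<le> k\<close>] by (simp only: of_int_add of_int_mult of_int_of_nat_eq distrib_right)
  qed
  also have "(\<Sum>j\<le>k. of_nat (Suc j) * of_int (coeffA (int (Suc j)) (int k - int (Suc j))) * falling (Suc j) z)
      = (\<Sum>j\<le>Suc k. of_nat j * of_int (coeffA (int j) (int k - int j)) * falling j z)"
    by (subst sum.atMost_Suc_shift) simp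
  also have "\<dots> = (\<Sum>j\<le>k. of_nat j * of_int (coeffA (int j) (int k - int j)) * falling j z)"
    using z by (simp add: add.commute)
  also have "\<dots> + (\<Sum>j\<le>k. of_int (coeffA (int j) (int k - int j)) * falling (Suc j) z)
    = z * (\<Sum>j\<le>k. of_int (coeffA (int j) (int k - int j)) * falling j z)"
    unfolding sum_distrib_left sum.distrib[symmetric]
    by (intro sum.cong refl) (simp add: falling_Suc algebra_simps)
  finally show ?case by (simp add: Suc)
qed

lemma prod_add_elem_sym:
  "(\<Prod>l=1..n. z + c * lam l) = (\<Sum>m\<le>n. c ^ m * elem_sym n lam m * z ^ (n - m))"
proof -
  have "(\<Prod>l=1..n. c * lam l + z) = (\<Sum>X\<in>Pow {1..n}. (\<Prod>l\<in>X. c * lam l) * (\<Prod>l\<in>{1..n} - X. z))"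
    by (rule prod_add) simp
  also have "\<dots> = (\<Sum>X\<in>Pow {1..n}. c ^ card X * (\<Prod>l\<in>X. lam l) * z ^ (n - card X))"
    by (intro sum.cong refl) (auto simp: prod.distrib card_Diff_subset finite_subset)
  also have "\<dots> = (\<Sum>m\<le>n. \<Sum>X | X \<in> Pow {1..n} \<and> card X = m. c ^ card X * (\<Prod>l\<in>X. lam l) * z ^ (n - card X))"
    by (rule sum.group[symmetric]) (auto dest: card_mono[rotated])
  also have "\<dots> = (\<Sum>m\<le>n. c ^ m * elem_sym n lam m * z ^ (n - m))"
    unfolding elem_sym_def sum_distrib_left sum_distrib_right
    by (intro sum.cong) auto
  finally show ?thesis by (simp add: add.commute)
qed

text \<open>Equivalently, the operator with terms V_(n,j) x^j (d/dx)^j multiplies x^z by the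
  right-hand side. The product is expanded in powers of z, each power in falling factorials, and the
  triangular double sum is interchanged.\<close>

lemma sum_coeffV_falling:
  "(\<Sum>j\<le>n. coeffV n j lam * falling j z) = (\<Prod>l=1..n. z + of_nat n * lam l)"
proof -
  let ?a = "\<lambda>j m. of_int (coeffA (int j) (int n - int j - int m)) * of_nat n ^ m * elem_sym n lam m * falling j z"
  have "(\<Sum>j\<le>n. coeffV n j lam * falling j z) = (\<Sum>j\<le>n. \<Sum>m\<le>n - j. ?a j m)"
    by (simp add: coeffV_def sum_distrib_right atLeast0AtMost)
  also have "\<dots> = (\<Sum>(j, m)\<in>{(j, m). j + m \<le> n}. ?a j m)"
    by (subst sum.Sigma) (auto intro!: sum.cong)
  also have "\<dots> = (\<Sum>(m, j)\<in>{(m, j). m + j \<le> n}. ?a j m)"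
    by (rule sum.reindex_bij_witness[where i = prod.swap and j = prod.swap]) auto
  also have "\<dots> = (\<Sum>m\<le>n. \<Sum>j\<le>n - m. ?a j m)"
    by (subst sum.Sigma) (auto intro!: sum.cong)
  also have "\<dots> = (\<Sum>m\<le>n. of_nat n ^ m * elem_sym n lam m * z ^ (n - m))"
  proof (intro sum.cong refl)
    fix m assume m: "m \<in> {..n}"
    have "(\<Sum>j\<le>n - m. ?a j m) = of_nat n ^ m * elem_sym n lam m *
        (\<Sum>j\<le>n - m. of_int (coeffA (int j) (int (n - m) - int j)) * falling j z)"
      unfolding sum_distrib_left using m by (intro sum.cong refl) (simp add: of_nat_diff algebra_simps)
    then show "(\<Sum>j\<le>n - m. ?a j m) = of_nat n ^ m * elem_sym n lam m * z ^ (n - m)"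
      by (simp add: sum_coeffA_falling)
  qed
  finally show ?thesis by (simp only: prod_add_elem_sym)
qed

section \<open>Contours far to the left\<close>

text \<open>From far left one moves vertically, below the minimum \<open>r\<close> of the graph, to
  the height of \<open>z\<close>, and then horizontally to \<open>z\<close>; the graph meets that
  height only once, to the right of \<open>z\<close>.\<close>

lemma left_of_contour_graph:
  assumes \<rho>: "\<And>t. r \<le> \<rho> t" and z: "Re z < \<rho> (Im z)"
  shows "left_of_contour (\<lambda>t. Complex (\<rho> t) t) z"
  unfolding left_of_contour_def
proof (intro exI allI impI)
  fix u :: complex assume u: "Re u < min r (Re z)"
  let ?v = "Complex (Re u) (Im z)"
  have "Complex (\<rho> t) t \<notin> closed_segment u ?v" for t
    using u \<rho>[of t] by (simp add: closed_segment_same_Re)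
  then have "range (\<lambda>t. Complex (\<rho> t) t) \<inter> closed_segment u ?v = {}" by auto
  moreover have "range (\<lambda>t. Complex (\<rho> t) t) \<inter> closed_segment ?v z = {}"
    using u z by (auto simp: closed_segment_same_Im closed_segment_eq_real_ivl)
  ultimately have "connected_component (- range (\<lambda>t. Complex (\<rho> t) t)) u ?v"
      "connected_component (- range (\<lambda>t. Complex (\<rho> t) t)) ?v z"
    unfolding connected_component_def
    by (metis Int_commute connected_segment(1) disjoint_eq_subset_Compl ends_in_segment)+
  then show "connected_component (- range (\<lambda>t. Complex (\<rho> t) t)) u z"
    by (rule connected_component_trans)
qed

text \<open>The bulge passes to the right of the poles at small heights, while the ends approach Re
  s = \<open>\<sigma>\<close>. A rational bulge keeps the derivative continuous everywhere, as
  differentiation under the integral requires, and changing \<open>\<sigma>\<close> translates the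
  curve.\<close>

definition hump :: "real \<Rightarrow> real \<Rightarrow> real \<Rightarrow> complex" where
  "hump \<sigma> K t = Complex (\<sigma> + K / (1 + t\<^sup>2)) t"

lemma Re_hump [simp]: "Re (hump \<sigma> K t) = \<sigma> + K / (1 + t\<^sup>2)"
  and Im_hump [simp]: "Im (hump \<sigma> K t) = t"
  by (simp_all add: hump_def)

lemma one_plus_sq_pos [simp]: "1 + t\<^sup>2 > (0::real)" "1 + t\<^sup>2 \<noteq> (0::real)"
proof -
  show "1 + t\<^sup>2 > 0" by (rule add_pos_nonneg) auto
  then show "1 + t\<^sup>2 \<noteq> 0" by (metis less_irrefl)
qed

lemma has_vector_derivative_hump:
  "(hump \<sigma> K has_vector_derivative Complex (- (2 * K * t / (1 + t\<^sup>2)\<^sup>2)) 1) (at t)"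
proof -
  have "((\<lambda>t. \<sigma> + K / (1 + t\<^sup>2)) has_real_derivative - (2 * K * t / (1 + t\<^sup>2)\<^sup>2)) (at t)"
    using one_plus_sq_pos(2)[of t] by (auto intro!: derivative_eq_intros simp: power2_eq_square)
  then have "((\<lambda>t. of_real (\<sigma> + K / (1 + t\<^sup>2)) + \<i> * of_real t) has_vector_derivative
     of_real (- (2 * K * t / (1 + t\<^sup>2)\<^sup>2)) + \<i> * of_real 1) (at t)"
    by (intro has_vector_derivative_add has_vector_derivative_mult_right has_vector_derivative_of_real) auto
  then show ?thesis by (simp add: hump_def[abs_def] Complex_eq)
qed

lemma vector_derivative_hump:
  "vector_derivative (hump \<sigma> K) (at t) = Complex (- (2 * K * t / (1 + t\<^sup>2)\<^sup>2)) 1"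
  by (rule vector_derivative_at[OF has_vector_derivative_hump])

lemma continuous_on_hump [continuous_intros]:
  "continuous_on S f \<Longrightarrow> continuous_on S (\<lambda>t. hump \<sigma> K (f t))"
  unfolding hump_def Complex_eq by (intro continuous_intros) auto

lemma continuous_on_vector_derivative_hump:
  "continuous_on S (\<lambda>t. vector_derivative (hump \<sigma> K) (at t))"
  unfolding vector_derivative_hump Complex_eq by (intro continuous_intros) auto

lemma hump_bounds:
  assumes "K \<ge> 0"
  shows "\<sigma> \<le> Re (hump \<sigma> K t)" "Re (hump \<sigma> K t) \<le> \<sigma> + K"
    "\<bar>t\<bar> \<ge> max 1 K \<Longrightarrow> Re (hump \<sigma> K t) \<le> \<sigma> + 1"
    "norm (vector_derivative (hump \<sigma> K) (at t)) \<le> 2 * K + 1"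
proof -
  show "\<sigma> \<le> Re (hump \<sigma> K t)" using assms by (simp add: less_imp_le)
  show "Re (hump \<sigma> K t) \<le> \<sigma> + K" using assms by (simp add: divide_le_eq mult_left_mono algebra_simps)
  show "Re (hump \<sigma> K t) \<le> \<sigma> + 1" if t: "\<bar>t\<bar> \<ge> max 1 K"
  proof -
    have "K * 1 \<le> \<bar>t\<bar> * \<bar>t\<bar>" using t assms by (intro mult_mono) auto
    then have "K \<le> 1 + t\<^sup>2" by (simp add: power2_eq_square flip: abs_mult)
    then show ?thesis by simp
  qed
  have "\<bar>t\<bar> \<le> 1 + t\<^sup>2"
  proof (cases "\<bar>t\<bar> \<le> 1")
    case True
    then show ?thesis using zero_le_power2[of t] by linarith
  next
    case False
    then have "\<bar>t\<bar> ^ 1 \<le> \<bar>t\<bar> ^ 2" by (intro power_increasing) auto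
    then show ?thesis by simp
  qed
  also have "1 + t\<^sup>2 \<le> (1 + t\<^sup>2)\<^sup>2" by (rule self_le_power) auto
  finally have "\<bar>2 * K * t / (1 + t\<^sup>2)\<^sup>2\<bar> \<le> 2 * K"
    using assms mult_left_mono[of "\<bar>t\<bar>" "(1 + t\<^sup>2)\<^sup>2" "2 * K"] by (simp add: abs_mult divide_le_eq)
  then show "norm (vector_derivative (hump \<sigma> K) (at t)) \<le> 2 * K + 1"
    using cmod_le[of "vector_derivative (hump \<sigma> K) (at t)"] by (simp add: vector_derivative_hump)
qed

lemma ascending_hump:
  assumes "K \<ge> 0"
  shows "ascending (hump \<sigma> K)"
  unfolding ascending_def
proof (intro conjI allI exI impI)
  show "hump \<sigma> K piecewise_C1_differentiable_on {-R..R}" for R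
    unfolding piecewise_C1_differentiable_on_def C1_differentiable_on_eq
    using has_vector_derivative_hump
    by (intro conjI exI[of _ "{}"] continuous_on_hump continuous_on_id continuous_on_vector_derivative_hump)
      (auto intro: differentiableI_vector)
  show "\<bar>Re (hump \<sigma> K t)\<bar> \<le> \<bar>\<sigma>\<bar> + K" for t
    using hump_bounds(1,2)[OF assms, of \<sigma> t] by linarith
qed simp

lemma left_of_hump:
  assumes "K \<ge> 0" "Re z < Re (hump \<sigma> K (Im z))"
  shows "left_of_contour (hump \<sigma> K) z"
  using left_of_contour_graph[of \<sigma> "\<lambda>t. \<sigma> + K / (1 + t\<^sup>2)" z] assms
  by (simp add: hump_def[abs_def])

section \<open>The kernel, its poles and its functional equation\<close>

definition mellin_kernel :: "nat \<Rightarrow> (nat \<Rightarrow> int) \<Rightarrow> (nat \<Rightarrow> complex) \<Rightarrow> complex \<Rightarrow> complex" where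
  "mellin_kernel n sgns lam s = (\<Prod>l=1..n. Gamma (s - lam l) * e2pi (of_int (sgns l) * (s - lam l) / 4))"

definition kernel_poles :: "nat \<Rightarrow> (nat \<Rightarrow> complex) \<Rightarrow> complex set" where
  "kernel_poles n lam = (\<Union>l\<in>{1..n}. range (\<lambda>k. lam l - of_nat k))"

lemma notin_kernel_poles_iff:
  "s \<notin> kernel_poles n lam \<longleftrightarrow> (\<forall>l\<in>{1..n}. s - lam l \<notin> \<int>\<^sub>\<le>\<^sub>0)"
proof -
  have "s = lam l - of_nat k \<longleftrightarrow> s - lam l = - of_nat k" for l k
    by (auto simp: algebra_simps)
  then show ?thesis
    by (auto simp: kernel_poles_def elim!: nonpos_Ints_cases')
qed

lemma closed_kernel_poles: "closed (kernel_poles n lam)"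
proof -
  have "kernel_poles n lam = (\<Union>l\<in>{1..n}. (\<lambda>s. s - lam l) -` \<int>\<^sub>\<le>\<^sub>0)"
    using notin_kernel_poles_iff[of _ n lam] by blast
  then show ?thesis
    by (auto intro!: closed_UN closed_vimage continuous_intros)
qed

lemma kernel_poles_bounded:
  obtains c where "c > 0" "\<And>q. q \<in> kernel_poles n lam \<Longrightarrow> Re q \<le> c"
    "\<And>q. q \<in> kernel_poles n lam \<Longrightarrow> \<bar>Im q\<bar> \<le> c"
proof -
  define c where "c = (\<Sum>l=1..n. norm (lam l)) + 1"
  have c: "norm (lam l) \<le> c" if "l \<in> {1..n}" for l
    using member_le_sum[of l "{1..n}" "\<lambda>l. norm (lam l)"] that by (simp add: c_def)
  show ?thesis
  proof (rule that[of c])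
    show "c > 0" unfolding c_def by (intro add_nonneg_pos sum_nonneg) auto
    fix q assume "q \<in> kernel_poles n lam"
    then obtain l k where "l \<in> {1..n}" "q = lam l - of_nat k" by (auto simp: kernel_poles_def)
    then show "Re q \<le> c" "\<bar>Im q\<bar> \<le> c"
      using c[of l] abs_Re_le_cmod[of "lam l"] abs_Im_le_cmod[of "lam l"] by auto
  qed
qed

lemma finite_kernel_poles_right: "finite {q \<in> kernel_poles n lam. r \<le> Re q}"
proof (rule finite_subset)
  show "{q \<in> kernel_poles n lam. r \<le> Re q} \<subseteq>
      (\<Union>l\<in>{1..n}. (\<lambda>k. lam l - of_nat k) ` {..nat \<lceil>Re (lam l) - r\<rceil>})"
  proof safe
    fix q assume "q \<in> kernel_poles n lam" and r: "r \<le> Re q"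
    then obtain l k where lk: "l \<in> {1..n}" "q = lam l - of_nat k" by (auto simp: kernel_poles_def)
    then have "real k \<le> Re (lam l) - r" using r by simp
    then have "k \<le> nat \<lceil>Re (lam l) - r\<rceil>" by linarith
    then show "q \<in> (\<Union>l\<in>{1..n}. (\<lambda>k. lam l - of_nat k) ` {..nat \<lceil>Re (lam l) - r\<rceil>})"
      using lk by auto
  qed
qed auto

lemma holomorphic_on_mellin_kernel:
  "mellin_kernel n sgns lam holomorphic_on - kernel_poles n lam"
  unfolding mellin_kernel_def[abs_def] e2pi_def
  by (intro holomorphic_intros) (use notin_kernel_poles_iff in auto)

text \<open>Under s -> s + 1 a Gamma factor gains s - \<open>lam l\<close>, and its exponential
  factor gains e(\<open>sgns l\<close> / 4) = \<open>sgns l\<close> i, with inverse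
  -\<open>sgns l\<close> i.\<close>

lemma mellin_kernel_plus_one:
  assumes "s \<notin> kernel_poles n lam" "\<forall>l\<in>{1..n}. sgns l \<in> {1, -1}"
  shows "mellin_kernel n sgns lam s * (\<Prod>l=1..n. s - lam l) =
    of_int (sign_prod n sgns) * (- \<i>) ^ n * mellin_kernel n sgns lam (s + 1)"
proof -
  have factor: "Gamma (s - lam l) * e2pi (of_int (sgns l) * (s - lam l) / 4) * (s - lam l) =
      of_int (sgns l) * (- \<i>) * (Gamma (s + 1 - lam l) * e2pi (of_int (sgns l) * (s + 1 - lam l) / 4))"
    if l: "l \<in> {1..n}" for l
  proof -
    have "s - lam l \<notin> \<int>\<^sub>\<le>\<^sub>0" using assms(1) l notin_kernel_poles_iff by blast
    then have G: "Gamma (s + 1 - lam l) = (s - lam l) * Gamma (s - lam l)"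
      using Gamma_plus1[of "s - lam l"] by (simp add: algebra_simps)
    have "e2pi (of_int (sgns l) * (s + 1 - lam l) / 4) =
        e2pi (of_int (sgns l) * (s - lam l) / 4) * e2pi (of_int (sgns l) / 4)"
      unfolding e2pi_def exp_add[symmetric] by (rule arg_cong[where f = exp]) (simp add: field_simps)
    also have "e2pi (of_int (sgns l) / 4) = of_int (sgns l) * \<i>"
    proof -
      have "exp (\<i> * (of_real pi / 2)) = \<i>"
        using cis_conv_exp[of "pi / 2"] cis_pi_half by simp
      then have "exp (2 * of_real pi * \<i> * (1 / 4)) = \<i>" "exp (2 * of_real pi * \<i> * (- 1 / 4)) = - \<i>"
        by (simp_all add: mult_ac exp_minus)
      moreover have "sgns l = 1 \<or> sgns l = - 1" using assms(2) l by auto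
      ultimately show ?thesis unfolding e2pi_def by auto
    qed
    finally have e: "e2pi (of_int (sgns l) * (s + 1 - lam l) / 4) =
        e2pi (of_int (sgns l) * (s - lam l) / 4) * (of_int (sgns l) * \<i>)" .
    have "sgns l = 1 \<or> sgns l = - 1" using assms(2) l by auto
    then have "of_int (sgns l) * of_int (sgns l) = (1::complex)" by auto
    then show ?thesis unfolding G e by (simp add: mult_ac)
  qed
  have "mellin_kernel n sgns lam s * (\<Prod>l=1..n. s - lam l) =
      (\<Prod>l=1..n. of_int (sgns l) * (- \<i>) * (Gamma (s + 1 - lam l) * e2pi (of_int (sgns l) * (s + 1 - lam l) / 4)))"
    unfolding mellin_kernel_def prod.distrib[symmetric] by (intro prod.cong refl factor)
  also have "\<dots> = of_int (sign_prod n sgns) * (- \<i>) ^ n * mellin_kernel n sgns lam (s + 1)"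
    unfolding mellin_kernel_def sign_prod_def by (simp only: prod.distrib) simp
  finally show ?thesis .
qed

section \<open>The Mellin-Barnes integrand\<close>

text \<open>Gamma bounds are in terms of Im (s - \<mu>), the contour estimates in terms of Im s.
  Once these heights agree up to a factor 2, powers with bounded exponent agree up to a
  constant.\<close>

lemma powr_le_comparable:
  fixes r t p K :: real
  assumes "t > 0" "t / 2 \<le> r" "r \<le> 2 * t" "\<bar>p\<bar> \<le> K"
  shows "r powr p \<le> 2 powr K * t powr p"
proof -
  have r: "r > 0" using assms(1,2) by linarith
  have "ln t - ln 2 \<le> ln r" using assms ln_le_cancel_iff[of "t / 2" r] r by (simp add: ln_div)
  moreover have "ln r \<le> ln 2 + ln t" using assms ln_le_cancel_iff[of r "2 * t"] r by (simp add: ln_mult)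
  ultimately have "\<bar>ln r - ln t\<bar> \<le> ln 2" by linarith
  then have "\<bar>p\<bar> * \<bar>ln r - ln t\<bar> \<le> K * ln 2" using assms(4) by (intro mult_mono) auto
  then have "p * (ln r - ln t) \<le> K * ln 2" by (metis abs_ge_self abs_mult order_trans)
  then have "exp (p * ln r) \<le> exp (K * ln 2 + p * ln t)" by (simp add: algebra_simps)
  then show ?thesis using r assms(1) by (simp add: powr_def exp_add)
qed

text \<open>The exponential factor has modulus at most exp(pi |Im (s - \<mu>)| / 2), exactly
  cancelling the decay of Gamma.\<close>

lemma gamma_factor_bound:
  assumes "\<sigma> = 1 \<or> \<sigma> = (-1::int)"
  shows "\<exists>C T. C > 0 \<and> T \<ge> 1 \<and> (\<forall>s. Re s \<in> {a..b} \<and> T \<le> \<bar>Im s\<bar> \<longrightarrow>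
    norm (Gamma (s - \<mu>) * e2pi (of_int \<sigma> * (s - \<mu>) / 4)) \<le> C * \<bar>Im s\<bar> powr (Re s - Re \<mu> - 1/2))"
proof -
  obtain C where C: "C > 0" and bound: "\<And>u t. u \<in> {a - Re \<mu>..b - Re \<mu>} \<Longrightarrow> \<bar>t\<bar> \<ge> 1 \<Longrightarrow>
      norm (Gamma (Complex u t)) \<le> C * \<bar>t\<bar> powr (u - 1/2) * exp (- (pi * \<bar>t\<bar> / 2))"
    using norm_Gamma_le_strip[of "a - Re \<mu>" "b - Re \<mu>"] by blast
  \<comment> \<open>\<open>K\<close> bounds the modulus of the exponent throughout the strip. Beyond
    the next constant \<open>T\<close>, the height relative to \<mu> is at least 1 and between half
    and twice |Im s|.\<close>
  define K where "K = \<bar>a - Re \<mu>\<bar> + \<bar>b - Re \<mu>\<bar> + 1/2"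
  define T where "T = 2 * (\<bar>Im \<mu>\<bar> + 1)"
  have "norm (Gamma (s - \<mu>) * e2pi (of_int \<sigma> * (s - \<mu>) / 4)) \<le> (C * 2 powr K) * \<bar>Im s\<bar> powr (Re s - Re \<mu> - 1/2)"
    if s: "Re s \<in> {a..b}" "T \<le> \<bar>Im s\<bar>" for s
  proof -
    let ?t = "Im (s - \<mu>)"
    have t: "\<bar>?t\<bar> \<ge> 1" "\<bar>Im s\<bar> > 0" "\<bar>Im s\<bar> / 2 \<le> \<bar>?t\<bar>" "\<bar>?t\<bar> \<le> 2 * \<bar>Im s\<bar>"
    proof -
      have s': "2 * (\<bar>Im \<mu>\<bar> + 1) \<le> \<bar>Im s\<bar>" using s(2) by (simp add: T_def)
      show "\<bar>?t\<bar> \<ge> 1" "\<bar>Im s\<bar> > 0" using s' by simp_all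
      show "\<bar>Im s\<bar> / 2 \<le> \<bar>?t\<bar>" using s' abs_triangle_ineq2[of "Im s" "Im \<mu>"] by simp
      show "\<bar>?t\<bar> \<le> 2 * \<bar>Im s\<bar>" using s' abs_triangle_ineq4[of "Im s" "Im \<mu>"] by simp
    qed
    have "norm (e2pi (of_int \<sigma> * (s - \<mu>) / 4)) = exp (- (pi * (of_int \<sigma> * ?t) / 2))"
      by (simp add: e2pi_def)
    also have "\<dots> \<le> exp (pi * \<bar>?t\<bar> / 2)"
    proof -
      have "pi * (- (of_int \<sigma> * ?t)) \<le> pi * \<bar>?t\<bar>" using assms by (intro mult_left_mono) auto
      then show ?thesis by simp
    qed
    finally have e: "norm (e2pi (of_int \<sigma> * (s - \<mu>) / 4)) \<le> exp (pi * \<bar>?t\<bar> / 2)" .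
    have "norm (Gamma (s - \<mu>)) = norm (Gamma (Complex (Re s - Re \<mu>) ?t))"
      by (metis complex_surj minus_complex.simps(1))
    also have "\<dots> \<le> C * \<bar>?t\<bar> powr (Re s - Re \<mu> - 1/2) * exp (- (pi * \<bar>?t\<bar> / 2))"
      using s t by (intro bound) auto
    finally have "norm (Gamma (s - \<mu>)) * norm (e2pi (of_int \<sigma> * (s - \<mu>) / 4)) \<le>
        (C * \<bar>?t\<bar> powr (Re s - Re \<mu> - 1/2) * exp (- (pi * \<bar>?t\<bar> / 2))) * exp (pi * \<bar>?t\<bar> / 2)"
      using e C by (intro mult_mono) auto
    also have "\<dots> = C * \<bar>?t\<bar> powr (Re s - Re \<mu> - 1/2)"
      by (simp add: mult.assoc flip: exp_add)
    also have "\<dots> \<le> C * (2 powr K * \<bar>Im s\<bar> powr (Re s - Re \<mu> - 1/2))"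
      using C t s by (intro mult_left_mono powr_le_comparable) (auto simp: K_def)
    finally show ?thesis by (simp add: norm_mult mult.assoc)
  qed
  moreover have "C * 2 powr K > 0" using C by simp
  moreover have "T \<ge> 1" by (simp add: T_def)
  ultimately show ?thesis by blast
qed

text \<open>The exponents of the n factors add up to n (Re s - 1/2) because the sum of the
  \<open>lam l\<close> vanishes; the right edge \<open>b\<close> of the strip is the worst
  case.\<close>

lemma mellin_kernel_bound:
  assumes sgns: "\<forall>l\<in>{1..n}. sgns l \<in> {1, -1}" and lam: "(\<Sum>l=1..n. lam l) = 0"
  shows "\<exists>C T. C > 0 \<and> T \<ge> 1 \<and> (\<forall>s. Re s \<in> {a..b} \<and> T \<le> \<bar>Im s\<bar> \<longrightarrow>
    norm (mellin_kernel n sgns lam s) \<le> C * \<bar>Im s\<bar> powr (real n * (b - 1/2)))"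
proof -
  have "\<forall>l\<in>{1..n}. \<exists>C T. C > 0 \<and> T \<ge> 1 \<and> (\<forall>s. Re s \<in> {a..b} \<and> T \<le> \<bar>Im s\<bar> \<longrightarrow>
    norm (Gamma (s - lam l) * e2pi (of_int (sgns l) * (s - lam l) / 4)) \<le> C * \<bar>Im s\<bar> powr (Re s - Re (lam l) - 1/2))"
    using sgns by (intro ballI gamma_factor_bound) auto
  then obtain C T where C: "\<And>l. l \<in> {1..n} \<Longrightarrow> C l > (0::real)" and T: "\<And>l. l \<in> {1..n} \<Longrightarrow> T l \<ge> (1::real)" and
    bound: "\<And>l s. l \<in> {1..n} \<Longrightarrow> Re s \<in> {a..b} \<Longrightarrow> T l \<le> \<bar>Im s\<bar> \<Longrightarrow>
    norm (Gamma (s - lam l) * e2pi (of_int (sgns l) * (s - lam l) / 4)) \<le> C l * \<bar>Im s\<bar> powr (Re s - Re (lam l) - 1/2)"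
    by metis
  define T' where "T' = 1 + (\<Sum>l=1..n. T l)"
  have T0: "T l \<ge> 0" if "l \<in> {1..n}" for l using T[OF that] by simp
  have TT: "T l \<le> T'" if "l \<in> {1..n}" for l
    using member_le_sum[of l "{1..n}" T] that T0 by (simp add: T'_def)
  have "norm (mellin_kernel n sgns lam s) \<le> (\<Prod>l=1..n. C l) * \<bar>Im s\<bar> powr (real n * (b - 1/2))"
    if s: "Re s \<in> {a..b}" "T' \<le> \<bar>Im s\<bar>" for s
  proof -
    have s1: "\<bar>Im s\<bar> \<ge> 1" using s(2) sum_nonneg[of "{1..n}" T] T0 by (simp add: T'_def)
    have "norm (mellin_kernel n sgns lam s) \<le> (\<Prod>l=1..n. C l * \<bar>Im s\<bar> powr (Re s - Re (lam l) - 1/2))"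
      unfolding mellin_kernel_def prod_norm[symmetric]
    proof (intro prod_mono conjI bound)
      fix l assume "l \<in> {1..n}"
      then show "T l \<le> \<bar>Im s\<bar>" using TT[of l] s(2) by simp
    qed (use s in auto)
    also have "\<dots> = (\<Prod>l=1..n. C l) * \<bar>Im s\<bar> powr (\<Sum>l=1..n. Re s - Re (lam l) - 1/2)"
      using s1 by (subst powr_sum) (auto simp: prod.distrib)
    also have "(\<Sum>l=1..n. Re s - Re (lam l) - 1/2) = real n * (Re s - 1/2)"
      using arg_cong[OF lam, of Re] by (simp add: sum_subtractf right_diff_distrib)
    also have "(\<Prod>l=1..n. C l) * \<bar>Im s\<bar> powr (real n * (Re s - 1/2)) \<le> (\<Prod>l=1..n. C l) * \<bar>Im s\<bar> powr (real n * (b - 1/2))"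
      using s s1 C by (intro mult_left_mono powr_mono prod_nonneg) (auto intro: less_imp_le)
    finally show ?thesis .
  qed
  moreover have "(\<Prod>l=1..n. C l) > 0" using C by (intro prod_pos) auto
  moreover have "T' \<ge> 1" using sum_nonneg[of "{1..n}" T] T0 by (simp add: T'_def)
  ultimately show ?thesis by blast
qed

definition mellin_integrand :: "nat \<Rightarrow> (nat \<Rightarrow> int) \<Rightarrow> (nat \<Rightarrow> complex) \<Rightarrow> real \<Rightarrow> complex \<Rightarrow> complex" where
  "mellin_integrand n sgns lam x s = mellin_kernel n sgns lam s * of_real x powr (- of_nat n * s)"

lemma of_real_powr_eq_exp: "x > 0 \<Longrightarrow> of_real x powr (s::complex) = exp (s * of_real (ln x))"
  by (simp add: powr_def Ln_of_real)

lemma holomorphic_on_mellin_integrand: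
  assumes "x > 0"
  shows "mellin_integrand n sgns lam x holomorphic_on - kernel_poles n lam"
  unfolding mellin_integrand_def[abs_def] of_real_powr_eq_exp[OF assms]
  by (intro holomorphic_intros holomorphic_on_mellin_kernel)

lemma mellin_integrand_bound:
  assumes "\<forall>l\<in>{1..n}. sgns l \<in> {1, -1}" "(\<Sum>l=1..n. lam l) = 0" and x: "x > 0"
  shows "\<exists>C T. C > 0 \<and> T \<ge> 1 \<and> (\<forall>s. Re s \<in> {a..b} \<and> T \<le> \<bar>Im s\<bar> \<longrightarrow>
    norm (mellin_integrand n sgns lam x s) \<le> C * \<bar>Im s\<bar> powr (real n * (b - 1/2)))"
proof -
  obtain C T where C: "C > 0" and T: "T \<ge> 1" and bound: "\<And>s. Re s \<in> {a..b} \<Longrightarrow> T \<le> \<bar>Im s\<bar> \<Longrightarrow>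
    norm (mellin_kernel n sgns lam s) \<le> C * \<bar>Im s\<bar> powr (real n * (b - 1/2))"
    using mellin_kernel_bound[OF assms(1,2)] by metis
  define D where "D = exp (real n * (\<bar>a\<bar> + \<bar>b\<bar>) * \<bar>ln x\<bar>)"
  have "norm (mellin_integrand n sgns lam x s) \<le> (C * D) * \<bar>Im s\<bar> powr (real n * (b - 1/2))"
    if s: "Re s \<in> {a..b}" "T \<le> \<bar>Im s\<bar>" for s
  proof -
    have "real n * - (Re s * ln x) \<le> real n * (\<bar>Re s\<bar> * \<bar>ln x\<bar>)"
      unfolding abs_mult[symmetric] by (intro mult_left_mono abs_ge_minus_self) simp
    also have "\<dots> \<le> real n * ((\<bar>a\<bar> + \<bar>b\<bar>) * \<bar>ln x\<bar>)"
      using s(1) by (intro mult_left_mono mult_right_mono) auto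
    finally have "norm (of_real x powr (- of_nat n * s) :: complex) \<le> D"
      using x by (simp add: of_real_powr_eq_exp D_def mult.assoc)
    then have "norm (mellin_integrand n sgns lam x s) \<le> (C * \<bar>Im s\<bar> powr (real n * (b - 1/2))) * D"
      unfolding mellin_integrand_def norm_mult using bound[OF s] C by (intro mult_mono) auto
    then show ?thesis by (simp add: mult_ac)
  qed
  moreover have "C * D > 0" using C by (simp add: D_def)
  ultimately show ?thesis using T by blast
qed

text \<open>Integrability over a bounded symmetric interval is a by-product of the evaluation by
  Cauchy's theorem, so corners need no separate treatment. The ends are covered by the power
  bound.\<close>

lemma integrable_along_ascending:
  assumes asc: "ascending \<gamma>"
    and left: "\<forall>q\<in>kernel_poles n lam. left_of_contour \<gamma> q"
    and holo: "f holomorphic_on - kernel_poles n lam"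
    and strip: "\<forall>\<^sub>F t in at_infinity. Re (\<gamma> t) \<in> {a..b}"
    and vd: "\<forall>\<^sub>F T in at_top. continuous_on {T..} (\<lambda>t. vector_derivative \<gamma> (at t)) \<and>
       continuous_on {..-T} (\<lambda>t. vector_derivative \<gamma> (at t))"
      "\<forall>\<^sub>F t in at_infinity. norm (vector_derivative \<gamma> (at t)) \<le> D"
    and bound: "\<And>s. Re s \<in> {a..b} \<Longrightarrow> T \<le> \<bar>Im s\<bar> \<Longrightarrow> norm (f s) \<le> C * \<bar>Im s\<bar> powr e"
    and e: "e < -1" and C: "C > 0"
  shows "(\<lambda>t. f (\<gamma> t) * vector_derivative \<gamma> (at t)) integrable_on UNIV"
proof -
  obtain c where c: "\<And>q. q \<in> kernel_poles n lam \<Longrightarrow> Re q \<le> c" "\<And>q. q \<in> kernel_poles n lam \<Longrightarrow> \<bar>Im q\<bar> \<le> c"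
    using kernel_poles_bounded[of n lam] by metis
  have mid: "\<forall>\<^sub>F R in at_top. ((\<lambda>t. f (\<gamma> t) * vector_derivative \<gamma> (at t)) has_integral
       - contour_integral (closing_path R (\<gamma> R) (\<gamma> (- R))) f) {-R..R}"
    by (rule eventually_contour_integral_closing_path[where c = c and P = "kernel_poles n lam"])
      (use asc left holo c closed_kernel_poles finite_kernel_poles_right in auto)
  obtain T' where T': "\<And>t. T' \<le> \<bar>t\<bar> \<Longrightarrow> Im (\<gamma> t) = t" using asc by (auto simp: ascending_def)
  obtain B where B: "\<And>t. B \<le> \<bar>t\<bar> \<Longrightarrow> Re (\<gamma> t) \<in> {a..b} \<and> norm (vector_derivative \<gamma> (at t)) \<le> D"
    using eventually_conj[OF strip vd(2)] unfolding eventually_at_infinity real_norm_def by blast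
  have ev: "\<forall>\<^sub>F R in at_top. R \<ge> max (max 1 T) (max T' B)" by (rule eventually_ge_at_top)
  obtain R where R: "(\<lambda>t. f (\<gamma> t) * vector_derivative \<gamma> (at t)) integrable_on {-R..R}"
      "continuous_on {R..} (\<lambda>t. vector_derivative \<gamma> (at t))"
      "continuous_on {..-R} (\<lambda>t. vector_derivative \<gamma> (at t))" "R \<ge> 1" "R \<ge> T" "R \<ge> T'" "R \<ge> B"
    using eventually_happens'[OF _ eventually_conj[OF mid eventually_conj[OF vd(1) ev]]] by auto
  have \<gamma>: "continuous_on UNIV \<gamma>"
  proof (rule continuous_at_imp_continuous_on, safe)
    fix t
    have "continuous_on {- (\<bar>t\<bar> + 1)..\<bar>t\<bar> + 1} \<gamma>" by (rule ascending_continuous_on[OF asc])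
    then show "isCont \<gamma> t" by (rule continuous_on_interior) auto
  qed
  have "continuous_on UNIV (\<lambda>t. f (\<gamma> t))"
    using left left_of_contour_notin_range
    by (intro continuous_on_compose2[OF holomorphic_on_imp_continuous_on[OF holo] \<gamma>]) blast
  then have f\<gamma>: "continuous_on S (\<lambda>t. f (\<gamma> t))" for S by (rule continuous_on_subset) auto
  show ?thesis
  proof (rule integrable_on_UNIV_if_power_decay[OF R(1) _ e])
    fix t assume t: "R \<le> \<bar>t\<bar>"
    have "norm (f (\<gamma> t)) \<le> C * \<bar>t\<bar> powr e"
      using bound[of "\<gamma> t"] T'[of t] B[of t] t R by auto
    moreover have "norm (vector_derivative \<gamma> (at t)) \<le> D" using B[of t] t R by auto
    ultimately have "norm (f (\<gamma> t) * vector_derivative \<gamma> (at t)) \<le> (C * \<bar>t\<bar> powr e) * D"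
      unfolding norm_mult using C by (intro mult_mono) auto
    then show "norm (f (\<gamma> t) * vector_derivative \<gamma> (at t)) \<le> (C * D) * \<bar>t\<bar> powr e" by (simp add: mult_ac)
  qed (use R in \<open>auto intro!: continuous_on_mult f\<gamma>\<close>)
qed

section \<open>Contours with vertical ends\<close>

lemma has_vector_derivative_vertical_end:
  assumes "\<And>t. T \<le> \<bar>t\<bar> \<Longrightarrow> \<gamma> t = Complex \<sigma> t" "T < \<bar>t\<bar>"
  shows "(\<gamma> has_vector_derivative \<i>) (at t)"
proof (rule has_vector_derivative_transform_within_open)
  show "((\<lambda>t. of_real \<sigma> + \<i> * of_real t) has_vector_derivative \<i>) (at t)"
    by (auto intro!: derivative_eq_intros has_vector_derivative_of_real)
  show "open {t. T < \<bar>t\<bar>}" by (intro open_Collect_less continuous_intros)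
  show "of_real \<sigma> + \<i> * of_real s = \<gamma> s" if "s \<in> {t. T < \<bar>t\<bar>}" for s
    using that assms(1)[of s] by (simp add: Complex_eq)
qed (use assms in auto)

lemma ascending_vertical_ends:
  assumes T: "0 < T" and ends: "\<And>t. T \<le> \<bar>t\<bar> \<Longrightarrow> \<gamma> t = Complex \<sigma> t"
    and mid: "\<gamma> piecewise_C1_differentiable_on {-T..T}"
  shows "ascending \<gamma>"
  unfolding ascending_def
proof (intro conjI allI)
  show "\<exists>T M. \<forall>t. T \<le> \<bar>t\<bar> \<longrightarrow> Im (\<gamma> t) = t \<and> \<bar>Re (\<gamma> t)\<bar> \<le> M"
    using ends by (intro exI[of _ T] exI[of _ "\<bar>\<sigma>\<bar>"]) simp
next
  fix R
  define R' where "R' = max R T"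
  obtain S where S: "finite S" "\<gamma> C1_differentiable_on {-T..T} - S" and cont: "continuous_on {-T..T} \<gamma>"
    using mid by (auto simp: piecewise_C1_differentiable_on_def)
  \<comment> \<open>The vertical ends may meet the middle part at an angle, so -T and T join the
    exceptional points.\<close>
  let ?A = "{-R'..R'} - (S \<union> {-T, T})"
  have "continuous_on ({-R'..-T} \<union> {T..R'}) (\<lambda>t. Complex \<sigma> t)"
    unfolding Complex_eq by (intro continuous_intros)
  then have "continuous_on ({-R'..-T} \<union> {T..R'}) \<gamma>"
    by (rule continuous_on_eq) (use ends T in auto)
  then have "continuous_on (({-R'..-T} \<union> {T..R'}) \<union> {-T..T}) \<gamma>"
    using cont by (rule continuous_on_closed_Un[rotated 2]) auto
  moreover have "({-R'..-T} \<union> {T..R'}) \<union> {-T..T} = {-R'..R'}" using T by (auto simp: R'_def)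
  ultimately have "continuous_on {-R'..R'} \<gamma>" by simp
  moreover have "\<gamma> C1_differentiable_on ?A"
    unfolding C1_differentiable_on_eq continuous_on_eq_continuous_within
  proof (intro conjI ballI)
    fix t assume t: "t \<in> ?A"
    consider "T < \<bar>t\<bar>" | "t \<in> {-T..T} - S" "t \<in> {-T<..<T}" using t by force
    then show "\<gamma> differentiable at t"
      by cases (use S(2) has_vector_derivative_vertical_end[OF ends] in
        \<open>auto simp: C1_differentiable_on_eq intro: differentiableI_vector\<close>)
  next
    fix t assume t: "t \<in> ?A"
    consider "T < \<bar>t\<bar>" | "t \<in> {-T..T} - S" "t \<in> {-T<..<T}" using t by force
    then show "continuous (at t within ?A) (\<lambda>t. vector_derivative \<gamma> (at t))"
    proof cases
      case 1
      have "isCont (\<lambda>t. vector_derivative \<gamma> (at t)) t"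
      proof (rule continuous_on_interior)
        show "continuous_on {t. T < \<bar>t\<bar>} (\<lambda>t. vector_derivative \<gamma> (at t))"
          by (rule continuous_on_eq[OF continuous_on_const[of _ \<i>]])
            (use vector_derivative_at[OF has_vector_derivative_vertical_end[OF ends]] in auto)
        have "open {t. T < \<bar>t\<bar>}" by (intro open_Collect_less continuous_intros)
        then show "t \<in> interior {t. T < \<bar>t\<bar>}" using 1 by (simp add: interior_open)
      qed
      then show ?thesis by (rule continuous_at_imp_continuous_at_within)
    next
      case 2
      have "at t within ?A = at t within ({-T..T} - S)"
        using 2 by (intro at_within_nhd[of t "{-T<..<T}"]) (auto simp: R'_def)
      then show ?thesis
        using S(2) 2 by (simp add: C1_differentiable_on_eq continuous_on_eq_continuous_within)
    qed
  qed
  ultimately have "\<gamma> piecewise_C1_differentiable_on {-R'..R'}"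
    unfolding piecewise_C1_differentiable_on_def using S(1) by (intro conjI exI[of _ "S \<union> {-T, T}"]) auto
  then show "\<gamma> piecewise_C1_differentiable_on {-R..R}"
    by (rule piecewise_C1_differentiable_on_subset) (auto simp: R'_def)
qed

section \<open>The Bessel function over humps, and its differential equation\<close>

lemma bessel_J_eq_integral:
  "bessel_J n sgns lam \<gamma> x = 1 / (2 * of_real pi * \<i>) *
    integral UNIV (\<lambda>t. mellin_integrand n sgns lam x (\<gamma> t) * vector_derivative \<gamma> (at t))"
  by (simp add: bessel_J_def infinite_contour_integral_def mellin_integrand_def mellin_kernel_def)

text \<open>The left-hand side does not mention \<open>\<sigma>\<close>, so different humps give the
  same value. This replaces a contour shift: it is applied with \<open>\<sigma>\<close> equal to -4
  and to -3.\<close>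

lemma bessel_J_eq_integral_hump:
  assumes n: "n \<ge> 1" and sgns: "\<forall>l\<in>{1..n}. sgns l \<in> {1, -1}" and lam: "(\<Sum>l=1..n. lam l) = 0"
    and \<gamma>: "bessel_contour n lam \<gamma>" and x: "x > 0"
    and K: "K \<ge> 0" and \<sigma>: "\<sigma> \<le> -3"
    and left: "\<forall>q\<in>kernel_poles n lam. left_of_contour (hump \<sigma> K) q"
  shows "bessel_J n sgns lam \<gamma> x = 1 / (2 * of_real pi * \<i>) *
    integral UNIV (\<lambda>t. mellin_integrand n sgns lam x (hump \<sigma> K t) * vector_derivative (hump \<sigma> K) (at t))"
proof -
  obtain \<tau> T where \<tau>: "\<tau> < 1 / 2 + 1 / real n * (Re (\<Sum>l=1..n. lam l) - 1)" and T: "0 < T"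
    and ends: "\<And>t. T \<le> \<bar>t\<bar> \<Longrightarrow> \<gamma> t = Complex \<tau> t" and mid: "\<gamma> piecewise_C1_differentiable_on {-T..T}"
    using \<gamma> unfolding bessel_contour_def by blast
  have left\<gamma>: "\<forall>q\<in>kernel_poles n lam. left_of_contour \<gamma> q"
    using \<gamma> by (auto simp: bessel_contour_def kernel_poles_def)
  have asc: "ascending \<gamma>" using T ends mid by (rule ascending_vertical_ends)
  have asch: "ascending (hump \<sigma> K)" using K by (rule ascending_hump)
  let ?f = "mellin_integrand n sgns lam x"
  define a where "a = min \<tau> \<sigma>"
  \<comment> \<open>The strip contains the ends of both curves, those of the hump lying between
    \<open>\<sigma>\<close> and \<open>\<sigma> + 1\<close>. Its right edge stays below 1/2 - 1/n:
    for \<open>\<tau>\<close> by the contour condition, for \<open>\<sigma> + 1\<close> \<le> -2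
    since 1/n \<le> 1.\<close>
  define b where "b = max \<tau> (\<sigma> + 1)"
  have "b < 1/2 - 1 / real n"
  proof -
    have "1 / real n \<le> 1" using n by simp
    then show ?thesis using \<tau>[unfolded lam] \<sigma> by (simp add: b_def)
  qed
  then have e: "real n * (b - 1/2) < -1"
    using n by (simp add: field_simps)
  obtain C U where C: "C > 0" and U: "U \<ge> 1" and bound: "\<And>s. Re s \<in> {a..b} \<Longrightarrow> U \<le> \<bar>Im s\<bar> \<Longrightarrow>
      norm (?f s) \<le> C * \<bar>Im s\<bar> powr (real n * (b - 1/2))"
    using mellin_integrand_bound[OF sgns lam x] by metis
  have holo: "?f holomorphic_on - kernel_poles n lam" using x by (rule holomorphic_on_mellin_integrand)
  have strip: "\<forall>\<^sub>F t in at_infinity. Re (\<gamma> t) \<in> {a..b}"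
    unfolding eventually_at_infinity by (intro exI[of _ T]) (auto simp: ends a_def b_def)
  have striph: "\<forall>\<^sub>F t in at_infinity. Re (hump \<sigma> K t) \<in> {a..b}"
    unfolding eventually_at_infinity
  proof (intro exI[of _ "max 1 K"] allI impI)
    fix t :: real assume "max 1 K \<le> norm t"
    then show "Re (hump \<sigma> K t) \<in> {a..b}"
      using hump_bounds(1,3)[OF K, where \<sigma> = \<sigma> and t = t] unfolding a_def b_def real_norm_def atLeastAtMost_iff
      by linarith
  qed
  have vd: "vector_derivative \<gamma> (at t) = \<i>" if "T < \<bar>t\<bar>" for t
    by (rule vector_derivative_at[OF has_vector_derivative_vertical_end[OF ends that]])
  have int: "(\<lambda>t. ?f (\<gamma> t) * vector_derivative \<gamma> (at t)) integrable_on UNIV"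
  proof (rule integrable_along_ascending[OF asc left\<gamma> holo strip _ _ bound e C])
    show "\<forall>\<^sub>F t in at_infinity. norm (vector_derivative \<gamma> (at t)) \<le> 1"
      unfolding eventually_at_infinity by (intro exI[of _ "T + 1"]) (auto simp: vd)
    show "\<forall>\<^sub>F T in at_top. continuous_on {T..} (\<lambda>t. vector_derivative \<gamma> (at t)) \<and>
       continuous_on {..-T} (\<lambda>t. vector_derivative \<gamma> (at t))"
      using eventually_gt_at_top[of T]
    proof eventually_elim
      case (elim R)
      have outside: "continuous_on S (\<lambda>t. vector_derivative \<gamma> (at t))" if "S \<subseteq> {t. T < \<bar>t\<bar>}" for S
        by (rule continuous_on_eq[OF continuous_on_const[of _ \<i>]]) (use that vd in auto)
      show ?case by (intro conjI outside) (use elim T in auto)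
    qed
  qed
  have inth: "(\<lambda>t. ?f (hump \<sigma> K t) * vector_derivative (hump \<sigma> K) (at t)) integrable_on UNIV"
    by (rule integrable_along_ascending[OF asch left holo striph _ _ bound e C, where D = "2 * K + 1"])
      (auto intro!: always_eventually continuous_on_vector_derivative_hump hump_bounds(4) K)
  obtain c where c: "\<And>q. q \<in> kernel_poles n lam \<Longrightarrow> Re q \<le> c" "\<And>q. q \<in> kernel_poles n lam \<Longrightarrow> \<bar>Im q\<bar> \<le> c"
    using kernel_poles_bounded[of n lam] by metis
  have decay: "\<exists>T. \<forall>z. Re z \<in> {a..b} \<and> T \<le> \<bar>Im z\<bar> \<longrightarrow> norm (?f z) \<le> \<epsilon>" if "\<epsilon> > 0" for \<epsilon>
  proof -
    have "((\<lambda>t. C * t powr (real n * (b - 1/2))) \<longlongrightarrow> 0) at_top"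
      using e by (intro tendsto_mult_right_zero tendsto_neg_powr filterlim_ident) auto
    then have "\<forall>\<^sub>F t in at_top. C * t powr (real n * (b - 1/2)) < \<epsilon>"
      using that by (auto dest: order_tendstoD(2))
    then obtain V where V: "\<And>t. t \<ge> V \<Longrightarrow> C * t powr (real n * (b - 1/2)) < \<epsilon>"
      unfolding eventually_at_top_linorder by blast
    have "norm (?f z) \<le> \<epsilon>" if "Re z \<in> {a..b}" "max U V \<le> \<bar>Im z\<bar>" for z
      using bound[of z] V[of "\<bar>Im z\<bar>"] that by simp
    then show ?thesis by blast
  qed
  have "integral UNIV (\<lambda>t. ?f (\<gamma> t) * vector_derivative \<gamma> (at t)) =
      integral UNIV (\<lambda>t. ?f (hump \<sigma> K t) * vector_derivative (hump \<sigma> K) (at t))"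
    by (rule integral_along_ascending_eq[OF asc asch closed_kernel_poles c finite_kernel_poles_right
          left\<gamma> left holo strip striph decay int inth])
  then show ?thesis by (simp add: bessel_J_eq_integral)
qed

text \<open>At heights up to \<open>c\<close>, where all poles lie, the bulge is at least c + 5.
  With \<open>\<sigma>\<close> \<ge> -4 the curve there has real part at least c + 1. The same
  \<open>K\<close> thus serves both humps.\<close>

lemma hump_right_of_poles:
  assumes "\<sigma> \<ge> -4" and c: "c > 0" "\<And>q. q \<in> kernel_poles n lam \<Longrightarrow> Re q \<le> c" "\<And>q. q \<in> kernel_poles n lam \<Longrightarrow> \<bar>Im q\<bar> \<le> c"
    and K: "K = (c + 5) * (1 + c\<^sup>2)"
  shows "\<forall>q\<in>kernel_poles n lam. left_of_contour (hump \<sigma> K) q"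
proof
  fix q assume q: "q \<in> kernel_poles n lam"
  have "(Im q)\<^sup>2 \<le> c\<^sup>2" using c(1) c(3)[OF q] by (simp add: abs_le_square_iff[symmetric])
  then have "(c + 5) * (1 + (Im q)\<^sup>2) \<le> K" using c(1) unfolding K by (intro mult_left_mono) auto
  then have "c + 5 \<le> K / (1 + (Im q)\<^sup>2)" by (simp add: pos_le_divide_eq)
  moreover have "Re q \<le> c" by (rule c(2)[OF q])
  ultimately have "Re q < Re (hump \<sigma> K (Im q))" using assms(1) by simp
  moreover have "K \<ge> 0" using c(1) by (simp add: K)
  ultimately show "left_of_contour (hump \<sigma> K) q" by (intro left_of_hump)
qed

text \<open>Far out the real part is at most -3, so the kernel has exponent -7n/2, and the weight
  adds n + 1. The total 1 - 5n/2 is below -1 for every n \<ge> 1, which is why the asymptote -4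
  suffices.\<close>

lemma integrable_kernel_hump_weighted:
  assumes n: "n \<ge> 1" and sgns: "\<forall>l\<in>{1..n}. sgns l \<in> {1, -1}" and lam: "(\<Sum>l=1..n. lam l) = 0"
    and K: "K \<ge> 0" and left: "\<forall>q\<in>kernel_poles n lam. left_of_contour (hump (-4) K) q"
  shows "continuous_on UNIV (\<lambda>t. mellin_kernel n sgns lam (hump (-4) K t) * vector_derivative (hump (-4) K) (at t))"
    and "(\<lambda>t. norm (mellin_kernel n sgns lam (hump (-4) K t) * vector_derivative (hump (-4) K) (at t)) *
      (1 + norm (- of_nat n * hump (-4) K t)) ^ (n + 1)) integrable_on UNIV"
proof -
  let ?p = "hump (-4) K"
  let ?k = "\<lambda>t. mellin_kernel n sgns lam (?p t) * vector_derivative ?p (at t)"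
  let ?g = "\<lambda>t. norm (?k t) * (1 + norm (- of_nat n * ?p t)) ^ (n + 1)"
  have "range ?p \<subseteq> - kernel_poles n lam"
    using left left_of_contour_notin_range by blast
  then have "continuous_on UNIV (\<lambda>t. mellin_kernel n sgns lam (?p t))"
    by (intro continuous_on_compose2[OF holomorphic_on_imp_continuous_on[OF holomorphic_on_mellin_kernel]]
        continuous_on_hump continuous_on_id)
  then show cont: "continuous_on UNIV ?k"
    by (intro continuous_on_mult continuous_on_vector_derivative_hump)
  have contg: "continuous_on S ?g" for S
    by (rule continuous_on_subset[where s = UNIV]) (auto intro!: continuous_intros cont)
  obtain C T where C: "C > 0" and T: "T \<ge> 1" and bound: "\<And>s. Re s \<in> {-4..-3} \<Longrightarrow> T \<le> \<bar>Im s\<bar> \<Longrightarrow>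
    norm (mellin_kernel n sgns lam s) \<le> C * \<bar>Im s\<bar> powr (real n * (-3 - 1/2))"
    using mellin_kernel_bound[OF sgns lam, of "-4" "-3"] by metis
  define D where "D = 1 + real n * (5 + K)"
  define R where "R = max T (max 1 K)"
  show "?g integrable_on UNIV"
  proof (rule integrable_on_UNIV_if_power_decay)
    show "?g integrable_on {-R..R}" by (intro integrable_continuous_interval contg)
    show "R > 0" by (simp add: R_def)
    show "real n * (-3 - 1/2) + real (n + 1) < -1" using n by simp
    fix t assume t: "R \<le> \<bar>t\<bar>"
    then have t1: "\<bar>t\<bar> \<ge> 1" by (simp add: R_def)
    have Re: "Re (?p t) \<in> {-4..-3}"
      using hump_bounds(1,3)[OF K, where \<sigma> = "-4" and t = t] t unfolding R_def atLeastAtMost_iff by linarith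
    have "\<bar>Re (?p t)\<bar> \<le> 4" using Re unfolding atLeastAtMost_iff by linarith
    then have "norm (?p t) \<le> 4 + \<bar>t\<bar>"
      using cmod_le[of "?p t"] unfolding Im_hump by linarith
    also have "\<dots> \<le> (5 + K) * \<bar>t\<bar>"
    proof -
      have "0 \<le> K * \<bar>t\<bar>" using K by simp
      then show ?thesis using t1 unfolding distrib_right by linarith
    qed
    finally have "real n * norm (?p t) \<le> real n * ((5 + K) * \<bar>t\<bar>)" by (intro mult_left_mono) auto
    then have "1 + norm (- of_nat n * ?p t) \<le> D * \<bar>t\<bar>"
      using t1 by (simp add: D_def norm_mult algebra_simps)
    then have "(1 + norm (- of_nat n * ?p t)) ^ (n + 1) \<le> (D * \<bar>t\<bar>) ^ (n + 1)"
      by (intro power_mono) auto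
    also have "\<dots> = D ^ (n + 1) * \<bar>t\<bar> powr real (n + 1)"
      using t1 by (simp only: power_mult_distrib powr_realpow)
    finally have z: "(1 + norm (- of_nat n * ?p t)) ^ (n + 1) \<le> D ^ (n + 1) * \<bar>t\<bar> powr real (n + 1)" .
    have "norm (?k t) \<le> (C * \<bar>t\<bar> powr (real n * (-3 - 1/2))) * (2 * K + 1)"
      unfolding norm_mult using bound[of "?p t"] Re t hump_bounds(4)[OF K] C
      by (intro mult_mono) (auto simp: R_def)
    then have "?g t \<le> ((C * \<bar>t\<bar> powr (real n * (-3 - 1/2))) * (2 * K + 1)) * (D ^ (n + 1) * \<bar>t\<bar> powr real (n + 1))"
      using z C K by (intro mult_mono) auto
    also have "\<dots> = (C * (2 * K + 1) * D ^ (n + 1)) * \<bar>t\<bar> powr (real n * (-3 - 1/2) + real (n + 1))"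
      by (simp only: powr_add mult_ac)
    finally show "norm (?g t) \<le> (C * (2 * K + 1) * D ^ (n + 1)) * \<bar>t\<bar> powr (real n * (-3 - 1/2) + real (n + 1))"
      by simp
  qed (rule contg)+
qed

text \<open>This permits taking the finite sum over j under the integral sign.\<close>

lemma integrable_integral_exp_falling:
  fixes G z :: "real \<Rightarrow> complex"
  assumes cont: "continuous_on UNIV G" "continuous_on UNIV z"
    and Re: "\<And>t. \<bar>Re (z t)\<bar> \<le> M"
    and int: "(\<lambda>t. norm (G t) * (1 + norm (z t)) ^ (n + 1)) integrable_on UNIV" and j: "j \<le> n"
  shows "(\<lambda>t. G t * falling j (z t) * exp (z t * of_real y)) integrable_on UNIV"
proof (rule integrable_on_UNIV_if_dominated[OF _ int])
  fix t
  have "\<bar>Re (z t) * y\<bar> \<le> M * \<bar>y\<bar>" unfolding abs_mult by (intro mult_right_mono Re) auto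
  then have e: "norm (exp (z t * of_real y)) \<le> exp (M * \<bar>y\<bar>)" by simp
  have "norm (falling j (z t)) \<le> real (Suc j) ^ j * (1 + norm (z t)) ^ j"
    using norm_falling_le by (simp only: power_mult_distrib)
  also have "\<dots> \<le> real (Suc j) ^ j * (1 + norm (z t)) ^ (n + 1)"
    using j by (intro mult_left_mono power_increasing) auto
  finally have "norm (G t) * norm (falling j (z t)) * norm (exp (z t * of_real y))
      \<le> norm (G t) * (real (Suc j) ^ j * (1 + norm (z t)) ^ (n + 1)) * exp (M * \<bar>y\<bar>)"
    using e by (intro mult_mono) auto
  then show "norm (G t * falling j (z t) * exp (z t * of_real y)) \<le>
      (real (Suc j) ^ j * exp (M * \<bar>y\<bar>)) * (norm (G t) * (1 + norm (z t)) ^ (n + 1))"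
    by (simp only: norm_mult mult_ac)
qed (intro continuous_intros cont)

text \<open>\<open>vector_derivative\<close> has an unspecified value where no derivative exists, so
  differentiability of the lower derivatives is part of the conclusion; it makes every
  \<open>iter_deriv j w\<close> in the equation a genuine derivative.\<close>

theorem theorem10p6:
  fixes d :: nat and sgns :: "nat \<Rightarrow> int" and lam :: "nat \<Rightarrow> complex"
    and \<gamma> :: "real \<Rightarrow> complex" and w :: "real \<Rightarrow> complex"
  assumes "d \<ge> 1"
    and "\<forall>l\<in>{1..d+1}. sgns l \<in> {1, -1}"
    and "(\<Sum>l=1..d+1. lam l) = 0"
    and "bessel_contour (d+1) lam \<gamma>"
    and "\<forall>x>0. w x = bessel_J (d+1) sgns lam \<gamma> x"
  shows "\<forall>x>0.
    (\<forall>j\<le>d. iter_deriv j w differentiable (at x)) \<and>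
    (\<Sum>j=1..d+1. coeffV (d+1) j lam * of_real x ^ j * iter_deriv j w x) +
    (coeffV (d+1) 0 lam
       - of_int (sign_prod (d+1) sgns) * (\<i> * of_nat (d+1)) ^ (d+1) * of_real x ^ (d+1)) * w x = 0"
proof (intro allI impI)
  fix x :: real assume x: "x > 0"
  define n where "n = d + 1"
  have n: "n \<ge> 1" by (simp add: n_def)
  note hyps = assms(2-5)[folded n_def]
  obtain c where c: "c > 0" "\<And>q. q \<in> kernel_poles n lam \<Longrightarrow> Re q \<le> c" "\<And>q. q \<in> kernel_poles n lam \<Longrightarrow> \<bar>Im q\<bar> \<le> c"
    using kernel_poles_bounded[of n lam] by metis
  define K where "K = (c + 5) * (1 + c\<^sup>2)"
  have K: "K \<ge> 0" using c(1) by (simp add: K_def)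
  define p where "p = hump (-4) K"
  define p' where "p' t = vector_derivative p (at t)" for t
  \<comment> \<open>Derivatives are taken over the hump at -4; the hump at -3 is its translate by 1
    and recognises the outcome as a multiple of \<open>w x\<close>.\<close>
  have left4: "\<forall>q\<in>kernel_poles n lam. left_of_contour (hump (-4) K) q"
    and left3: "\<forall>q\<in>kernel_poles n lam. left_of_contour (hump (-3) K) q"
    using hump_right_of_poles[OF _ c K_def] by simp_all
  have p1: "hump (-3) K t = p t + 1" for t by (simp add: p_def complex_eq_iff)
  have p1': "vector_derivative (hump (-3) K) (at t) = p' t" for t
    by (simp add: p'_def p_def vector_derivative_hump)
  \<comment> \<open>The exponent of x in the integrand, hence the eigenvalue of x d/dx on
    it.\<close>
  define z where "z t = - of_nat n * p t" for t
  define \<kappa> where "\<kappa> = 1 / (2 * of_real pi * \<i>)"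
  define G where "G t = \<kappa> * (mellin_kernel n sgns lam (p t) * p' t)" for t
  have wG: "w y = integral UNIV (\<lambda>t. G t * exp (z t * of_real (ln y)))" if "y > 0" for y
  proof -
    have "w y = \<kappa> * integral UNIV (\<lambda>t. mellin_integrand n sgns lam y (p t) * p' t)"
      using bessel_J_eq_integral_hump[OF n hyps(1-3) that K _ left4] hyps(4) that
      by (simp add: \<kappa>_def p'_def p_def)
    also have "\<dots> = integral UNIV (\<lambda>t. \<kappa> * (mellin_integrand n sgns lam y (p t) * p' t))"
      by (rule integral_mult_right[symmetric])
    also have "(\<lambda>t. \<kappa> * (mellin_integrand n sgns lam y (p t) * p' t)) = (\<lambda>t. G t * exp (z t * of_real (ln y)))"
      using that by (simp add: mellin_integrand_def of_real_powr_eq_exp G_def z_def mult_ac)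
    finally show ?thesis .
  qed
  have wG1: "w x = \<kappa> * integral UNIV (\<lambda>t. mellin_integrand n sgns lam x (p t + 1) * p' t)"
    using bessel_J_eq_integral_hump[OF n hyps(1-3) x K _ left3] hyps(4) x
    by (simp add: \<kappa>_def p1 p1')
  have cont: "continuous_on UNIV (\<lambda>t. mellin_kernel n sgns lam (p t) * p' t)"
    and weighted: "(\<lambda>t. norm (mellin_kernel n sgns lam (p t) * p' t) * (1 + norm (z t)) ^ (n + 1)) integrable_on UNIV"
    using integrable_kernel_hump_weighted[OF n hyps(1,2) K left4] unfolding z_def p'_def p_def by blast+
  have contG: "continuous_on UNIV G"
    unfolding G_def[abs_def] by (intro continuous_on_mult continuous_on_const cont)
  have int: "(\<lambda>t. norm (G t) * (1 + norm (z t)) ^ (n + 1)) integrable_on UNIV"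
    using integrable_on_mult_right[OF weighted, of "norm \<kappa>"] by (simp add: G_def norm_mult mult_ac)
  have contz: "continuous_on UNIV z"
    unfolding z_def[abs_def] p_def by (intro continuous_intros)
  have Rez: "\<bar>Re (z t)\<bar> \<le> real n * (4 + K)" for t
  proof -
    have "\<bar>Re (p t)\<bar> \<le> 4 + K"
      using hump_bounds(1,2)[OF K, where \<sigma> = "-4" and t = t] K unfolding p_def by linarith
    then show ?thesis by (simp add: z_def abs_mult mult_left_mono)
  qed
  have derivs: "iter_deriv j w x =
      integral UNIV (\<lambda>t. G t * falling j (z t) * exp ((z t - of_nat j) * of_real (ln x)))" if "j \<le> n" for j
    by (rule iter_deriv_integral_exp_ln(1)[OF contG contz Rez int _ that x]) (rule wG)
  have diff: "iter_deriv j w differentiable (at x)" if "j < n" for j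
    by (rule iter_deriv_integral_exp_ln(2)[OF contG contz Rez int _ that x]) (rule wG)
  have exp_ln_x: "exp (of_nat j * of_real (ln x)) = complex_of_real x ^ j" for j
    using x by (simp add: exp_of_nat_mult exp_of_real)
  \<comment> \<open>The factor x^j restores the j units by which differentiation lowered the
    exponent, so all orders share one exponential.\<close>
  define I where "I j = (\<lambda>t. G t * falling j (z t) * exp (z t * of_real (ln x)))" for j
  have intI: "I j integrable_on UNIV" if "j \<le> n" for j
    unfolding I_def by (rule integrable_integral_exp_falling[OF contG contz Rez int that])
  have xj: "of_real x ^ j * iter_deriv j w x = integral UNIV (I j)" if "j \<le> n" for j
  proof -
    have "of_real x ^ j * iter_deriv j w x =
        integral UNIV (\<lambda>t. of_real x ^ j * (G t * falling j (z t) * exp ((z t - of_nat j) * of_real (ln x))))"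
      unfolding derivs[OF that] by (rule integral_mult_right[symmetric])
    also have "(\<lambda>t. of_real x ^ j * (G t * falling j (z t) * exp ((z t - of_nat j) * of_real (ln x)))) = I j"
      using x by (simp add: I_def left_diff_distrib exp_diff exp_ln_x)
    finally show ?thesis .
  qed
  define A where "A = of_int (sign_prod n sgns) * (\<i> * of_nat n) ^ n * of_real x ^ n"
  have "(\<Sum>j\<le>n. coeffV n j lam * of_real x ^ j * iter_deriv j w x) = (\<Sum>j\<le>n. coeffV n j lam * integral UNIV (I j))"
    by (intro sum.cong refl) (simp add: mult.assoc xj)
  also have "\<dots> = (\<Sum>j\<le>n. integral UNIV (\<lambda>t. coeffV n j lam * I j t))" by simp
  also have "\<dots> = integral UNIV (\<lambda>t. \<Sum>j\<le>n. coeffV n j lam * I j t)"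
    by (intro integral_sum[symmetric] integrable_on_mult_right intI) auto
  \<comment> \<open>The equation already holds between the integrands at each t; (-n)^n from
    \<open>z\<close> and (-i)^n from the functional equation combine to (in)^n.\<close>
  also have "(\<lambda>t. \<Sum>j\<le>n. coeffV n j lam * I j t) =
      (\<lambda>t. (A * \<kappa>) * (mellin_integrand n sgns lam x (p t + 1) * p' t))"
  proof
    fix t
    have "hump (-4) K t \<notin> kernel_poles n lam"
      using left4 left_of_contour_notin_range by blast
    then have pole: "p t \<notin> kernel_poles n lam" by (simp add: p_def)
    have "(\<Prod>l=1..n. z t + of_nat n * lam l) = (\<Prod>l=1..n. (- of_nat n) * (p t - lam l))"
      by (simp add: z_def algebra_simps)
    also have "\<dots> = (- of_nat n) ^ n * (\<Prod>l=1..n. p t - lam l)"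
      by (simp only: prod.distrib prod_constant card_atLeastAtMost) simp
    finally have "mellin_kernel n sgns lam (p t) * (\<Prod>l=1..n. z t + of_nat n * lam l) =
        (- of_nat n) ^ n * (mellin_kernel n sgns lam (p t) * (\<Prod>l=1..n. p t - lam l))"
      by (simp only: mult_ac)
    also have "\<dots> = ((- of_nat n) * (- \<i>)) ^ n * of_int (sign_prod n sgns) * mellin_kernel n sgns lam (p t + 1)"
      unfolding mellin_kernel_plus_one[OF pole hyps(1)] power_mult_distrib by (simp only: mult_ac)
    finally have kernel: "mellin_kernel n sgns lam (p t) * (\<Prod>l=1..n. z t + of_nat n * lam l) =
        of_int (sign_prod n sgns) * (\<i> * of_nat n) ^ n * mellin_kernel n sgns lam (p t + 1)"
      by (simp add: mult_ac)
    \<comment> \<open>Writing x^(-ns) as x^n x^(-n(s+1)) matches the shifted kernel and yields the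
      factor x^n of the equation.\<close>
    have "z t * of_real (ln x) = of_nat n * of_real (ln x) + (- of_nat n * (p t + 1)) * of_real (ln x)"
      by (simp add: z_def algebra_simps)
    then have shift: "exp (z t * of_real (ln x)) = of_real x ^ n * of_real x powr (- of_nat n * (p t + 1))"
      unfolding of_real_powr_eq_exp[OF x] by (simp only: exp_add exp_ln_x)
    have "(\<Sum>j\<le>n. coeffV n j lam * I j t) =
        G t * exp (z t * of_real (ln x)) * (\<Sum>j\<le>n. coeffV n j lam * falling j (z t))"
      unfolding I_def sum_distrib_left by (intro sum.cong refl) (simp only: mult_ac)
    also have "\<dots> = \<kappa> * p' t * exp (z t * of_real (ln x)) *
        (mellin_kernel n sgns lam (p t) * (\<Prod>l=1..n. z t + of_nat n * lam l))"
      unfolding sum_coeffV_falling G_def by (simp only: mult_ac)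
    also have "\<dots> = (A * \<kappa>) * (mellin_integrand n sgns lam x (p t + 1) * p' t)"
      unfolding kernel shift A_def mellin_integrand_def by (simp only: mult_ac)
    finally show "(\<Sum>j\<le>n. coeffV n j lam * I j t) = (A * \<kappa>) * (mellin_integrand n sgns lam x (p t + 1) * p' t)" .
  qed
  \<comment> \<open>The remaining integral is the representation of \<open>w x\<close> over the hump
    at -3.\<close>
  also have "integral UNIV \<dots> = A * w x"
    unfolding wG1 mult.assoc by (simp only: integral_mult_right)
  finally have "(\<Sum>j\<le>n. coeffV n j lam * of_real x ^ j * iter_deriv j w x) = A * w x" .
  moreover have "(\<Sum>j\<le>n. coeffV n j lam * of_real x ^ j * iter_deriv j w x) =
      coeffV n 0 lam * w x + (\<Sum>j=1..n. coeffV n j lam * of_real x ^ j * iter_deriv j w x)"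
    by (simp add: atMost_atLeast0 sum.atLeast_Suc_atMost iter_deriv_def)
  ultimately have "(\<Sum>j=1..n. coeffV n j lam * of_real x ^ j * iter_deriv j w x) + (coeffV n 0 lam - A) * w x = 0"
    by (simp add: algebra_simps)
  moreover have "\<forall>j\<le>d. iter_deriv j w differentiable (at x)"
    using diff by (simp add: n_def)
  ultimately show "(\<forall>j\<le>d. iter_deriv j w differentiable (at x)) \<and>
    (\<Sum>j=1..d+1. coeffV (d+1) j lam * of_real x ^ j * iter_deriv j w x) +
    (coeffV (d+1) 0 lam
       - of_int (sign_prod (d+1) sgns) * (\<i> * of_nat (d+1)) ^ (d+1) * of_real x ^ (d+1)) * w x = 0"
    unfolding A_def n_def by blast
qed

end
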